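(* Let $0<r<1$. Then the closed unit disk $\overline{\mathbb{D}}$ is a minimal spectral set for each of the classes $C_\alpha^*$, $C_\alpha\cup C_\alpha^*$ and $C_1$.
   Context: All operators are bounded linear maps on complex Hilbert spaces. $C_\alpha$ is the class of invertible operators $T$ with $-T^{*2}T^2+(1+r^2)T^*T-r^2I\ge0$; $C_\alpha^*=\{T: T^*\in C_\alpha\}$; $C_1$ is the class of all invertible contractions (invertible operators of norm at most $1$). For compact $X\subset\mathbb{C}$, $Rat(X)$ is the algebra of rational functions with poles off $X$; $X$ is a spectral set for an operator $T$ if $\sigma(T)\subseteq X$ and $\|f(T)\|\le\sup_{\xi\in X}|f(\xi)|$ for all $f\in Rat(X)$. A compact set $X$ is a minimal spectral set for a class $\mathcal{T}$ of operators if $X$ is a spectral set for every member of $\mathcal{T}$ and for every proper compact subset $X'$ of $X$ there is $T\in\mathcal{T}$ such that $X'$ is not a spectral set for $T$. *)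

theory Defs
  imports
    "HOL-Algebra.Module"
    "HOL-Analysis.Analysis"
    "HOL-Library.Equipollence"
    "HOL-Computational_Algebra.Polynomial"
begin

text \<open>
  The statement ranges over operators on varying Hilbert spaces, so Hilbert spaces are
  objects with explicit carriers.  They extend the library's module record (the ring fields
  \<open>mult\<close> and \<open>one\<close> of that record play no role) by an inner product that is linear in the
  first argument.
\<close>

definition complex_ring :: "complex ring" where
  "complex_ring = \<lparr>carrier = UNIV, monoid.mult = (*), one = 1, ring.zero = 0, add = (+)\<rparr>"

record 'a hilbert = "(complex, 'a) module" +
  cinner :: "'a \<Rightarrow> 'a \<Rightarrow> complex"

definition hnorm :: "'a hilbert \<Rightarrow> 'a \<Rightarrow> real" where
  "hnorm H x = sqrt (Re (cinner H x x))"

locale hilbert_space =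
  Module.module complex_ring H for H :: "'a hilbert" (structure) +
  assumes cinner_add_left:
      "\<lbrakk>x \<in> carrier H; y \<in> carrier H; z \<in> carrier H\<rbrakk>
       \<Longrightarrow> cinner H (x \<oplus> y) z = cinner H x z + cinner H y z"
    and cinner_smult_left:
      "\<lbrakk>x \<in> carrier H; z \<in> carrier H\<rbrakk> \<Longrightarrow> cinner H (a \<odot> x) z = a * cinner H x z"
    and cinner_commute:
      "\<lbrakk>x \<in> carrier H; y \<in> carrier H\<rbrakk> \<Longrightarrow> cinner H y x = cnj (cinner H x y)"
    and cinner_self_nonneg:
      "x \<in> carrier H \<Longrightarrow> cinner H x x \<in> \<real>\<^sub>\<ge>\<^sub>0"
    and cinner_self_eq_zero:
      "\<lbrakk>x \<in> carrier H; cinner H x x = 0\<rbrakk> \<Longrightarrow> x = \<zero>"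
    and complete:
      "\<lbrakk>\<And>n. s n \<in> carrier H;
        \<And>e. e > 0 \<Longrightarrow> \<exists>N. \<forall>m\<ge>N. \<forall>n\<ge>N. hnorm H (s m \<ominus> s n) < e\<rbrakk>
       \<Longrightarrow> \<exists>x\<in>carrier H. (\<lambda>n. hnorm H (s n \<ominus> x)) \<longlonglongrightarrow> 0"

text \<open>
  Operators are functions on the type \<open>'a\<close>, of which only the values on the carrier matter.
\<close>

definition bounded_ops :: "'a hilbert \<Rightarrow> ('a \<Rightarrow> 'a) set" where
  "bounded_ops H = {T. T \<in> carrier H \<rightarrow> carrier H
     \<and> (\<forall>x\<in>carrier H. \<forall>y\<in>carrier H. T (x \<oplus>\<^bsub>H\<^esub> y) = T x \<oplus>\<^bsub>H\<^esub> T y)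
     \<and> (\<forall>a. \<forall>x\<in>carrier H. T (a \<odot>\<^bsub>H\<^esub> x) = a \<odot>\<^bsub>H\<^esub> T x)
     \<and> (\<exists>K. \<forall>x\<in>carrier H. hnorm H (T x) \<le> K * hnorm H x)}"

definition op_norm :: "'a hilbert \<Rightarrow> ('a \<Rightarrow> 'a) \<Rightarrow> real" where
  "op_norm H T = (SUP x\<in>{x \<in> carrier H. hnorm H x \<le> 1}. hnorm H (T x))"

definition op_invertible :: "'a hilbert \<Rightarrow> ('a \<Rightarrow> 'a) \<Rightarrow> bool" where
  "op_invertible H T \<longleftrightarrow>
     (\<exists>S\<in>bounded_ops H. \<forall>x\<in>carrier H. S (T x) = x \<and> T (S x) = x)"

definition op_spectrum :: "'a hilbert \<Rightarrow> ('a \<Rightarrow> 'a) \<Rightarrow> complex set" where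
  "op_spectrum H T = {l. \<not> op_invertible H (\<lambda>x. T x \<ominus>\<^bsub>H\<^esub> l \<odot>\<^bsub>H\<^esub> x)}"

definition op_adjoint :: "'a hilbert \<Rightarrow> ('a \<Rightarrow> 'a) \<Rightarrow> 'a \<Rightarrow> 'a" where
  "op_adjoint H T y =
     (THE z. z \<in> carrier H \<and> (\<forall>x\<in>carrier H. cinner H (T x) y = cinner H x z))"

definition op_nonneg :: "'a hilbert \<Rightarrow> ('a \<Rightarrow> 'a) \<Rightarrow> bool" where
  "op_nonneg H A \<longleftrightarrow> (\<forall>x\<in>carrier H. cinner H (A x) x \<in> \<real>\<^sub>\<ge>\<^sub>0)"

definition poly_op :: "'a hilbert \<Rightarrow> complex poly \<Rightarrow> ('a \<Rightarrow> 'a) \<Rightarrow> 'a \<Rightarrow> 'a" where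
  "poly_op H p T x = (\<Oplus>\<^bsub>H\<^esub>i\<in>{..degree p}. coeff p i \<odot>\<^bsub>H\<^esub> (T ^^ i) x)"

text \<open>
  The rational function \<open>p/q\<close> is represented by the pair \<open>(p, q)\<close>.  Not requiring the fraction
  to be reduced gives the same functions, since cancelling common factors keeps \<open>q\<close> free of
  zeros on \<open>X\<close>; the condition \<open>q \<noteq> 0\<close> is only relevant for \<open>X = {}\<close>.
\<close>

definition Rat :: "complex set \<Rightarrow> (complex poly \<times> complex poly) set" where
  "Rat X = {(p, q). q \<noteq> 0 \<and> (\<forall>\<xi>\<in>X. poly q \<xi> \<noteq> 0)}"

text \<open>
  The operator \<open>p(T) q(T)\<^sup>-\<^sup>1\<close>, which is meaningful when \<open>q\<close> has no zeros on the spectrum of \<open>T\<close>.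
\<close>

definition rat_op ::
    "'a hilbert \<Rightarrow> complex poly \<Rightarrow> complex poly \<Rightarrow> ('a \<Rightarrow> 'a) \<Rightarrow> 'a \<Rightarrow> 'a" where
  "rat_op H p q T x = poly_op H p T (inv_into (carrier H) (poly_op H q T) x)"

definition spectral_set :: "complex set \<Rightarrow> 'a hilbert \<Rightarrow> ('a \<Rightarrow> 'a) \<Rightarrow> bool" where
  "spectral_set X H T \<longleftrightarrow>
     op_spectrum H T \<subseteq> X \<and>
     (\<forall>(p, q)\<in>Rat X. op_norm H (rat_op H p q T) \<le> (SUP \<xi>\<in>X. cmod (poly p \<xi> / poly q \<xi>)))"

text \<open>
  A class of operators is a set of pairs \<open>(H, T)\<close> of a Hilbert space with carrier in \<open>'a\<close> and
  an operator on it; the type \<open>'a\<close> acts as the universe of vectors.  Nonzero Hilbert spaces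
  with carrier in \<open>'a\<close> exist only if \<open>'a\<close> has at least the cardinality of the continuum, and
  then there are carriers of every finite and countable dimension; a statement about
  existence of operators therefore needs \<open>(UNIV :: complex set) \<lesssim> (UNIV :: 'a set)\<close>.
\<close>

definition minimal_spectral_set ::
    "complex set \<Rightarrow> ('a hilbert \<times> ('a \<Rightarrow> 'a)) set \<Rightarrow> bool" where
  "minimal_spectral_set X \<T> \<longleftrightarrow>
     compact X \<and>
     (\<forall>(H, T)\<in>\<T>. spectral_set X H T) \<and>
     (\<forall>X'. compact X' \<and> X' \<subset> X \<longrightarrow> (\<exists>(H, T)\<in>\<T>. \<not> spectral_set X' H T))"

definition C_alpha :: "real \<Rightarrow> ('a hilbert \<times> ('a \<Rightarrow> 'a)) set" where
  "C_alpha r = {(H, T). hilbert_space H \<and> T \<in> bounded_ops H \<and> op_invertible H T \<and>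
     op_nonneg H (\<lambda>x.
       \<ominus>\<^bsub>H\<^esub> op_adjoint H T (op_adjoint H T (T (T x)))
       \<oplus>\<^bsub>H\<^esub> complex_of_real (1 + r\<^sup>2) \<odot>\<^bsub>H\<^esub> op_adjoint H T (T x)
       \<ominus>\<^bsub>H\<^esub> complex_of_real (r\<^sup>2) \<odot>\<^bsub>H\<^esub> x)}"

definition C_alpha_star :: "real \<Rightarrow> ('a hilbert \<times> ('a \<Rightarrow> 'a)) set" where
  "C_alpha_star r =
     {(H, T). hilbert_space H \<and> T \<in> bounded_ops H \<and> (H, op_adjoint H T) \<in> C_alpha r}"

definition C_1 :: "('a hilbert \<times> ('a \<Rightarrow> 'a)) set" where
  "C_1 = {(H, T). hilbert_space H \<and> T \<in> bounded_ops H \<and> op_invertible H T \<and> op_norm H T \<le> 1}"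

end

(*
Every operator in the classes is an invertible contraction.  For T in C_alpha the numbers
a(n) = |T^n x|^2, n in Z, satisfy a(n+2) - a(n+1) <= r^2 (a(n+1) - a(n)); if a(1) > a(0), then the
increments do not decay as n tends to minus infinity and a becomes negative.  That the closed disk
is spectral for contractions is von Neumann's inequality: with the positive form
D(u, v) = <u, v> - <Tu, Tv> one has |x|^2 = sum_k D(T^k x, T^k x) when T^n x tends to 0, and
multiplication by s(T) acts on the sequence T^k x as a polynomial in the backward shift, which
Parseval's identity over the roots of unity bounds by the supremum of |s|.  A denominator without
zeros in the disk is removed one linear factor z - a at a time, dividing 1 - (z/a)^n by z - a.

For minimality it suffices to find witnesses in C_alpha_star.  A missing point l with
r <= |l| <= 1 is detected by the scalar operator l.  If X misses a disk around a point mu with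
0 < |mu| < r, take the bilateral shift T with weights r on the negative and 1 on the other basis
vectors.  With b_c(z) = (z - c) / (1 - cnj c z) the function f = b_c^2 / b_mu is unimodular on the
unit circle and at most 1 on X when c is close to mu, but |f(T)| > 1 because f has a pole at mu:
T is isometric on the forward span of the basis and shorter than an isometry on the rest.
*)
theory Submission
  imports Defs "HOL-Computational_Algebra.Fundamental_Theorem_Algebra"
begin

section \<open>Von Neumann's inequality for forms on polynomials\<close>

text \<open>Von Neumann's inequality is usually read off from a unitary dilation, which lives on a
  larger Hilbert space. A Hermitian form on polynomials records all that is needed of T and x, and
  it can be exchanged for another form at every stage of the argument without constructing a space
  or an operator for it.

  The square in f = b_c^2 / b_mu is forced. If |b_c / b_mu| were at most 1 inside the disk near the
  whole unit circle, the radial derivatives of log |b_c| and log |b_mu| would give P_c >= P_mu for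
  the Poisson kernels; their means agree, so c = mu and the pole is lost. With the square only 2 P_c
  >= P_mu is required, and this holds for c near mu.

  The class condition for the adjoint lets the weights of a forward shift jump up from r to 1, the
  two extreme values allowed for a constant weight, whereas the shift itself violates the condition
  of C_alpha at the jump. The weights r make the solution y of (T - mu) y = e_0 longer than for the
  unitary shift, and y enters f(T) only through the residue of f at mu.

  Witnesses in C_alpha_star serve all three classes, since each of them contains it.\<close>

lemma linear_factor:
  fixes q :: "complex poly"
  assumes "Suc d = degree q"
  shows "\<exists>a q'. q = [:- a, 1:] * q' \<and> d = degree q'"
proof -
  have "\<not> constant (poly q)" using assms by (metis constant_degree nat.distinct(1))
  then obtain a where "poly q a = 0" using fundamental_theorem_of_algebra by blast
  then obtain q' where q': "q = [:- a, 1:] * q'" by (metis poly_eq_0_iff_dvd dvdE)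
  have "q' \<noteq> 0" using q' assms by auto
  then have "degree q = degree [:- a, 1:] + degree q'"
    unfolding q' by (intro degree_mult_eq) auto
  then show ?thesis using assms q' by auto
qed

lemma smult_sum_right: "smult a (\<Sum>i\<in>A. f i) = (\<Sum>i\<in>A. smult a (f i))"
  by (induction A rule: infinite_finite_induct) (auto simp: smult_add_right)

text \<open>Working with forms allows three replacements with no operator behind them: the defect
  form, the form of a dilated polynomial argument, and the form of the vector (T - a) x.
  \<open>commute\<close> is Hermitian symmetry, so diagonal values are real and taking
  \<open>Re\<close> of them loses nothing.\<close>

locale sesquilinear_form =
  fixes F :: "complex poly \<Rightarrow> complex poly \<Rightarrow> complex"
  assumes add_left: "F (p + q) s = F p s + F q s"
    and smult_left: "F (smult a p) s = a * F p s"
    and commute: "F q p = cnj (F p q)"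
begin

lemma add_right: "F s (p + q) = F s p + F s q"
  using add_left[of p q s] commute by (metis complex_cnj_add)

lemma smult_right: "F s (smult a p) = cnj a * F s p"
  using smult_left[of a p s] commute by (metis complex_cnj_mult)

lemma zero_left [simp]: "F 0 s = 0"
  using smult_left[of 0 0 s] by simp

lemma zero_right [simp]: "F s 0 = 0"
  using smult_right[of s 0 0] by simp

lemma diff_left: "F (p - q) s = F p s - F q s"
  using add_left[of p "smult (-1) q" s] smult_left[of "-1" q s] by simp

lemma diff_right: "F s (p - q) = F s p - F s q"
  using add_right[of s p "smult (-1) q"] smult_right[of s "-1" q] by simp

lemma sum_left: "F (\<Sum>i\<in>A. f i) s = (\<Sum>i\<in>A. F (f i) s)"
  by (induction A rule: infinite_finite_induct) (auto simp: add_left)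

lemma sum_right: "F s (\<Sum>i\<in>A. f i) = (\<Sum>i\<in>A. F s (f i))"
  by (induction A rule: infinite_finite_induct) (auto simp: add_right)

lemma smult_both: "F (smult a p) (smult a p) = (cmod a)\<^sup>2 * F p p"
  by (simp add: smult_left smult_right complex_norm_square mult_ac del: of_real_power)

end

section \<open>Parseval's identity over the roots of unity\<close>

lemma sum_cis_multiples:
  fixes m n L :: nat
  assumes "m < L" "n < L"
  shows "(\<Sum>t<L. cis (2 * pi * t / L) ^ m * cnj (cis (2 * pi * t / L) ^ n)) = (if m = n then of_nat L else 0)"
proof -
  define z where "z = cis (2 * pi * (real m - real n) / L)"
  have term_eq: "cis (2 * pi * t / L) ^ m * cnj (cis (2 * pi * t / L) ^ n) = z ^ t" for t :: nat
    unfolding z_def complex_cnj_power cis_cnj Complex.DeMoivre cis_mult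
    by (rule arg_cong[where f = cis]) (simp add: algebra_simps diff_divide_distrib)
  have zL: "z ^ L = 1"
  proof -
    have "z ^ L = cis (2 * pi * (real m - real n))"
      using assms unfolding z_def Complex.DeMoivre by simp
    then show ?thesis by (simp add: cis_multiple_2pi)
  qed
  show ?thesis
  proof (cases "m = n")
    case True
    then show ?thesis unfolding term_eq by (simp add: z_def)
  next
    case False
    \<comment> \<open>Otherwise \<open>L\<close> divides \<open>m - n\<close>, whose absolute value
      is below \<open>L\<close>.\<close>
    have "z \<noteq> 1"
    proof
      assume "z = 1"
      then have "cos (2 * pi * (real m - real n) / L) = 1"
        unfolding z_def by (metis cis.sel(1) one_complex.sel(1))
      then obtain k :: int where "2 * pi * (real m - real n) / L = of_int k * 2 * pi"
        by (auto simp: cos_one_2pi_int)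
      then have "(2 * pi) * (real m - real n) = (2 * pi) * (of_int k * real L)"
        using assms by (simp add: field_simps)
      then have "real m - real n = of_int k * real L"
        by simp
      then have "real_of_int (int m - int n) = real_of_int (k * int L)"
        by simp
      then have k: "int m - int n = k * int L"
        by (simp only: of_int_eq_iff)
      have "\<bar>int m - int n\<bar> < int L" using assms by linarith
      then have "\<bar>k\<bar> * int L < 1 * int L" using k by (simp add: abs_mult)
      then have "k = 0" using assms by (simp add: mult_less_cancel_right)
      with k False show False by simp
    qed
    then have "(\<Sum>t<L. z ^ t) = 0"
      using zL by (simp add: sum_gp_strict)
    then show ?thesis unfolding term_eq using False by simp
  qed
qed

context sesquilinear_form
begin

lemma parseval:
  fixes c :: "nat \<Rightarrow> complex poly" and L :: nat
  defines "w \<equiv> (\<lambda>t::nat. cis (2 * pi * t / L))"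
  shows "(\<Sum>t<L. F (\<Sum>m<L. smult (w t ^ m) (c m)) (\<Sum>m<L. smult (w t ^ m) (c m)))
       = of_nat L * (\<Sum>m<L. F (c m) (c m))"
proof -
  have left: "F (\<Sum>m<L. smult (w t ^ m) (c m)) q = (\<Sum>m<L. w t ^ m * F (c m) q)" for t q
    by (simp add: sum_left smult_left)
  have right: "F q (\<Sum>n<L. smult (w t ^ n) (c n)) = (\<Sum>n<L. cnj (w t ^ n) * F q (c n))" for t q
    by (simp add: sum_right smult_right)
  have "(\<Sum>t<L. F (\<Sum>m<L. smult (w t ^ m) (c m)) (\<Sum>m<L. smult (w t ^ m) (c m)))
      = (\<Sum>t<L. \<Sum>m<L. \<Sum>n<L. (w t ^ m * cnj (w t ^ n)) * F (c m) (c n))"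
    unfolding left by (simp add: right sum_distrib_left mult.assoc del: complex_cnj_power)
  also have "\<dots> = (\<Sum>m<L. \<Sum>t<L. \<Sum>n<L. (w t ^ m * cnj (w t ^ n)) * F (c m) (c n))"
    by (rule sum.swap)
  also have "\<dots> = (\<Sum>m<L. \<Sum>n<L. \<Sum>t<L. (w t ^ m * cnj (w t ^ n)) * F (c m) (c n))"
    by (rule sum.cong[OF refl], rule sum.swap)
  also have "\<dots> = (\<Sum>m<L. \<Sum>n<L. (\<Sum>t<L. w t ^ m * cnj (w t ^ n)) * F (c m) (c n))"
    by (simp add: sum_distrib_right)
  also have "\<dots> = (\<Sum>m<L. \<Sum>n<L. (if m = n then of_nat L else 0) * F (c m) (c n))"
    unfolding w_def by (intro sum.cong refl arg_cong2[where f = "(*)"] sum_cis_multiples) auto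
  also have "\<dots> = (\<Sum>m<L. of_nat L * F (c m) (c m))"
    by (intro sum.cong refl) (simp add: if_distrib[of "\<lambda>x. x * _"] sum.delta cong: if_cong)
  finally show ?thesis by (simp add: sum_distrib_left)
qed

end

locale positive_form = sesquilinear_form +
  assumes nonneg: "0 \<le> Re (F p p)"
begin

text \<open>At a root of unity w, applying s to the sequence of powers amounts to multiplication by
  the scalar s(1/w), which is bounded by \<open>M\<close>. Cutting the sequence at \<open>N\<close>
  spoils the coefficients at both ends; only \<open>N - degree s\<close> of them are genuine
  products of a power with \<open>s\<close>, hence the shorter sum on the left.\<close>

lemma parseval_bound:
  fixes s :: "complex poly" and N :: nat
  assumes M: "\<And>z. cmod z = 1 \<Longrightarrow> cmod (poly s z) \<le> M" and N: "degree s \<le> N"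
  shows "(\<Sum>n<N - degree s. Re (F (monom 1 n * s) (monom 1 n * s)))
       \<le> M\<^sup>2 * (\<Sum>k<N. Re (F (monom 1 k) (monom 1 k)))"
proof (cases "N = 0")
  case True
  then show ?thesis using N by simp
next
  case False
  define d where "d = degree s"
  \<comment> \<open>The product has degree below \<open>N + d\<close> in w, so this many roots of
    unity separate its coefficients.\<close>
  define L where "L = N + d"
  define w where "w = (\<lambda>t::nat. cis (2 * pi * t / L))"
  define X where "X = (\<lambda>k. monom (1::complex) k)"
  \<comment> \<open>The coefficients in \<open>w\<close> of \<open>w\<^sup>d s(w\<^sup>-\<^sup>1) \<cdot> (\<Sum>k<N. w\<^sup>k X\<^sup>k)\<close>; for \<open>d \<le> m < N\<close> this is \<open>X\<^sup>m\<^sup>-\<^sup>d s\<close>.\<close>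
  define c where "c = (\<lambda>m. \<Sum>i\<le>d. if d \<le> i + m \<and> i + m < N + d then smult (coeff s i) (X (i + m - d)) else 0)"
  define a where "a = (\<lambda>t. \<Sum>k<N. smult (w t ^ k) (X k))"
  have L: "L > 0" using False by (simp add: L_def)
  have w1: "cmod (w t) = 1" for t by (simp add: w_def)
  have wi: "w t ^ d * cnj (w t) ^ i = w t ^ (d - i)" if "i \<le> d" for t i
  proof -
    have "w t ^ d * cnj (w t) ^ i = w t ^ (d - i) * (w t * cnj (w t)) ^ i"
      using that by (simp add: power_mult_distrib flip: power_add mult.assoc)
    also have "w t * cnj (w t) = 1"
      using w1[of t] by (metis complex_norm_square of_real_1 power_one)
    finally show ?thesis by simp
  qed
  have prod_eq: "(\<Sum>m<L. smult (w t ^ m) (c m)) = smult (w t ^ d * poly s (cnj (w t))) (a t)" for t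
  proof -
    have "(\<Sum>m<L. smult (w t ^ m) (c m))
        = (\<Sum>i\<le>d. \<Sum>m<L. if d \<le> i + m \<and> i + m < N + d
            then smult (w t ^ m * coeff s i) (X (i + m - d)) else 0)"
      unfolding c_def by (subst sum.swap) (simp add: smult_sum_right if_distrib cong: if_cong)
    also have "\<dots> = (\<Sum>i\<le>d. \<Sum>k<N. smult (w t ^ (k + d - i) * coeff s i) (X k))"
    proof (rule sum.cong[OF refl])
      fix i assume "i \<in> {..d}"
      then have i: "i \<le> d" by simp
      have "(\<Sum>m<L. if d \<le> i + m \<and> i + m < N + d then smult (w t ^ m * coeff s i) (X (i + m - d)) else 0)
          = (\<Sum>m\<in>{m. d \<le> i + m \<and> i + m < N + d}. smult (w t ^ m * coeff s i) (X (i + m - d)))"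
        by (rule sum.mono_neutral_cong_right) (auto simp: L_def)
      also have "\<dots> = (\<Sum>k<N. smult (w t ^ (k + d - i) * coeff s i) (X k))"
        by (rule sum.reindex_bij_witness[of _ "\<lambda>k. k + d - i" "\<lambda>m. i + m - d"]) (use i in auto)
      finally show "(\<Sum>m<L. if d \<le> i + m \<and> i + m < N + d then smult (w t ^ m * coeff s i) (X (i + m - d)) else 0)
          = (\<Sum>k<N. smult (w t ^ (k + d - i) * coeff s i) (X k))" .
    qed
    also have "\<dots> = (\<Sum>i\<le>d. smult (w t ^ d * (coeff s i * cnj (w t) ^ i)) (a t))"
    proof (rule sum.cong[OF refl])
      fix i assume "i \<in> {..d}"
      then have i: "i \<le> d" by simp
      have "w t ^ (k + d - i) * coeff s i = w t ^ d * (coeff s i * cnj (w t) ^ i) * w t ^ k" for k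
      proof -
        have "w t ^ (k + d - i) = w t ^ k * w t ^ (d - i)"
          using i by (simp flip: power_add)
        then show ?thesis by (simp add: wi[OF i, symmetric] mult_ac)
      qed
      then show "(\<Sum>k<N. smult (w t ^ (k + d - i) * coeff s i) (X k))
               = smult (w t ^ d * (coeff s i * cnj (w t) ^ i)) (a t)"
        by (simp only: a_def smult_sum_right smult_smult)
    qed
    also have "\<dots> = smult (w t ^ d * poly s (cnj (w t))) (a t)"
      by (simp add: poly_altdef d_def sum_distrib_left smult_sum flip: smult_smult)
    finally show ?thesis .
  qed
  have a_eq: "a t = (\<Sum>m<L. smult (w t ^ m) (if m < N then X m else 0))" for t
    unfolding a_def by (rule sum.mono_neutral_cong_left) (auto simp: L_def)
  have "L * (\<Sum>n<N - d. Re (F (X n * s) (X n * s))) \<le> L * (\<Sum>m<L. Re (F (c m) (c m)))"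
  proof (rule mult_left_mono)
    have "(\<Sum>n<N - d. Re (F (X n * s) (X n * s))) = (\<Sum>m\<in>(\<lambda>n. n + d) ` {..<N - d}. Re (F (c m) (c m)))"
    proof (subst sum.reindex)
      show "(\<Sum>n<N - d. Re (F (X n * s) (X n * s))) = (\<Sum>n<N - d. ((\<lambda>m. Re (F (c m) (c m))) \<circ> (\<lambda>n. n + d)) n)"
      proof (rule sum.cong[OF refl])
        fix n assume "n \<in> {..<N - d}"
        then have n: "n < N - d" by simp
        have "c (n + d) = (\<Sum>i\<le>d. smult (coeff s i) (X (i + n)))"
          unfolding c_def using n by (intro sum.cong) auto
        also have "\<dots> = X n * (\<Sum>i\<le>d. monom (coeff s i) i)"
          by (simp add: sum_distrib_left X_def smult_monom mult_monom add.commute)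
        also have "(\<Sum>i\<le>d. monom (coeff s i) i) = s"
          unfolding d_def by (rule poly_as_sum_of_monoms)
        finally show "Re (F (X n * s) (X n * s)) = ((\<lambda>m. Re (F (c m) (c m))) \<circ> (\<lambda>n. n + d)) n"
          by simp
      qed
    qed (auto simp: inj_on_def)
    \<comment> \<open>The spoiled boundary coefficients are dropped here, by positivity of the
      form.\<close>
    also have "\<dots> \<le> (\<Sum>m<L. Re (F (c m) (c m)))"
      by (rule sum_mono2) (auto simp: L_def nonneg)
    finally show "(\<Sum>n<N - d. Re (F (X n * s) (X n * s))) \<le> (\<Sum>m<L. Re (F (c m) (c m)))" .
  qed simp
  also have "\<dots> = Re (\<Sum>t<L. F (\<Sum>m<L. smult (w t ^ m) (c m)) (\<Sum>m<L. smult (w t ^ m) (c m)))"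
    unfolding w_def parseval by (simp add: sum_distrib_left)
  also have "\<dots> = (\<Sum>t<L. (cmod (poly s (cnj (w t))))\<^sup>2 * Re (F (a t) (a t)))"
  proof -
    have "(cmod (w t ^ d * poly s (cnj (w t))))\<^sup>2 = (cmod (poly s (cnj (w t))))\<^sup>2" for t
      by (simp add: norm_mult norm_power w1)
    then show ?thesis unfolding prod_eq smult_both by (simp flip: of_real_power)
  qed
  also have "\<dots> \<le> (\<Sum>t<L. M\<^sup>2 * Re (F (a t) (a t)))"
    by (intro sum_mono mult_right_mono nonneg power_mono M) (auto simp: w1)
  also have "\<dots> = M\<^sup>2 * Re (\<Sum>t<L. F (a t) (a t))"
    by (simp add: sum_distrib_left)
  also have "(\<Sum>t<L. F (a t) (a t)) = of_nat L * (\<Sum>m<L. F (if m < N then X m else 0) (if m < N then X m else 0))"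
    unfolding a_eq w_def by (rule parseval)
  also have "(\<Sum>m<L. F (if m < N then X m else 0) (if m < N then X m else 0)) = (\<Sum>k<N. F (X k) (X k))"
    by (rule sum.mono_neutral_cong_right) (auto simp: L_def)
  finally have "L * (\<Sum>n<N - d. Re (F (X n * s) (X n * s))) \<le> L * (M\<^sup>2 * (\<Sum>k<N. Re (F (X k) (X k))))"
    by (simp add: mult_ac)
  then show ?thesis using L by (simp add: X_def d_def)
qed

end

section \<open>Von Neumann's inequality for contractive forms\<close>

text \<open>
  The forms of interest are \<open>F p q = \<langle>p(T)x, q(T)x\<rangle>\<close> for a contraction \<open>T\<close> and a fixed vector \<open>x\<close>;
  \<open>pCons 0\<close> is multiplication by the variable.
\<close>

locale contractive_form = positive_form +
  assumes shift_le: "Re (F (pCons 0 p) (pCons 0 p)) \<le> Re (F p p)"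
begin

lemma monom_mult_le: "Re (F (monom 1 n * p) (monom 1 n * p)) \<le> Re (F p p)"
proof (induction n)
  case 0
  then show ?case by (simp add: monom_0)
next
  case (Suc n)
  have "monom 1 (Suc n) * p = pCons 0 (monom 1 n * p)"
    by (simp add: monom_Suc)
  with Suc shift_le[of "monom 1 n * p"] show ?case by simp
qed

text \<open>Contractivity of \<open>F\<close> is exactly positivity of the defect. The defect itself
  need not be contractive again, which is why \<open>parseval_bound\<close> is stated for positive
  forms.\<close>

lemma defect_form: "positive_form (\<lambda>p q. F p q - F (pCons 0 p) (pCons 0 q))"
proof
  fix p q s :: "complex poly" and a :: complex
  show "F (p + q) s - F (pCons 0 (p + q)) (pCons 0 s) =
      F p s - F (pCons 0 p) (pCons 0 s) + (F q s - F (pCons 0 q) (pCons 0 s))"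
    using add_left[of "pCons 0 p" "pCons 0 q"] by (simp add: add_left)
  show "F (smult a p) s - F (pCons 0 (smult a p)) (pCons 0 s) =
      a * (F p s - F (pCons 0 p) (pCons 0 s))"
    using smult_left[of a "pCons 0 p"] by (simp add: smult_left algebra_simps)
  show "F q p - F (pCons 0 q) (pCons 0 p) = cnj (F p q - F (pCons 0 p) (pCons 0 q))"
    by (simp add: commute[of q p] commute[of "pCons 0 q" "pCons 0 p"])
  show "0 \<le> Re (F p p - F (pCons 0 p) (pCons 0 p))"
    using shift_le[of p] by simp
qed

text \<open>Sums of the defect form along an orbit telescope. With \<open>N = n + degree s\<close>
  in \<open>parseval_bound\<close> both sides telescope: the remainder at \<open>s\<close> vanishes
  in the limit by \<open>decay\<close>, and the remainder at 1 is nonnegative and can be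
  discarded.\<close>

lemma von_neumann_decaying:
  assumes M: "\<And>z. cmod z = 1 \<Longrightarrow> cmod (poly s z) \<le> M"
    and decay: "(\<lambda>n. Re (F (monom 1 n * s) (monom 1 n * s))) \<longlonglongrightarrow> 0"
  shows "Re (F s s) \<le> M\<^sup>2 * Re (F 1 1)"
proof -
  interpret D: positive_form "\<lambda>p q. F p q - F (pCons 0 p) (pCons 0 q)"
    by (rule defect_form)
  have telescope: "(\<Sum>k<n. Re (F (monom 1 k * p) (monom 1 k * p) - F (pCons 0 (monom 1 k * p)) (pCons 0 (monom 1 k * p))))
      = Re (F p p) - Re (F (monom 1 n * p) (monom 1 n * p))" for n p
    by (induction n) (auto simp: monom_0 monom_Suc)
  have "Re (F s s) - Re (F (monom 1 n * s) (monom 1 n * s)) \<le> M\<^sup>2 * Re (F 1 1)" for n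
  proof -
    have "Re (F s s) - Re (F (monom 1 n * s) (monom 1 n * s))
        \<le> M\<^sup>2 * (Re (F 1 1) - Re (F (monom 1 (n + degree s)) (monom 1 (n + degree s))))"
      using D.parseval_bound[of s M "n + degree s", OF M] telescope[of s n] telescope[of 1 "n + degree s"]
      by simp
    also have "\<dots> \<le> M\<^sup>2 * Re (F 1 1)"
      by (rule mult_left_mono) (simp_all add: nonneg)
    finally show ?thesis .
  qed
  moreover have "(\<lambda>n. Re (F s s) - Re (F (monom 1 n * s) (monom 1 n * s))) \<longlonglongrightarrow> Re (F s s) - 0"
    by (intro tendsto_intros decay)
  ultimately show ?thesis
    by (metis (no_types, lifting) LIMSEQ_le_const2 diff_zero)
qed

text \<open>Orbits of a contraction need not decay. Substituting \<rho> z for z, which stands for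
  passing from T to \<rho> T, again gives a contractive form, and now the orbit of \<open>s\<close>
  decays geometrically; then \<rho> tends to 1.\<close>

lemma von_neumann_polynomial:
  assumes M: "\<And>z. cmod z \<le> 1 \<Longrightarrow> cmod (poly s z) \<le> M"
  shows "Re (F s s) \<le> M\<^sup>2 * Re (F 1 1)"
proof -
  define dil where "dil = (\<lambda>\<rho>::real. \<lambda>p::complex poly. pcompose p [:0, of_real \<rho>:])"
  have bound: "Re (F (dil \<rho> s) (dil \<rho> s)) \<le> M\<^sup>2 * Re (F 1 1)" if \<rho>: "0 < \<rho>" "\<rho> < 1" for \<rho>
  proof -
    have dil_shift: "dil \<rho> (pCons 0 p) = smult \<rho> (pCons 0 (dil \<rho> p))" for p
      by (simp add: dil_def pcompose_pCons)
    have shrink: "Re (F (smult \<rho> (pCons 0 p)) (smult \<rho> (pCons 0 p))) \<le> \<rho>\<^sup>2 * Re (F p p)" for p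
      using shift_le[of p] unfolding smult_both
      by (simp add: mult_left_mono flip: of_real_power)
    interpret G: contractive_form "\<lambda>p q. F (dil \<rho> p) (dil \<rho> q)"
    proof
      fix p q r :: "complex poly" and a
      show "F (dil \<rho> (p + q)) (dil \<rho> r) = F (dil \<rho> p) (dil \<rho> r) + F (dil \<rho> q) (dil \<rho> r)"
        by (simp add: dil_def pcompose_add add_left)
      show "F (dil \<rho> (smult a p)) (dil \<rho> q) = a * F (dil \<rho> p) (dil \<rho> q)"
        by (simp add: dil_def pcompose_smult smult_left)
      show "F (dil \<rho> q) (dil \<rho> p) = cnj (F (dil \<rho> p) (dil \<rho> q))"
        by (rule commute)
      show "0 \<le> Re (F (dil \<rho> p) (dil \<rho> p))" by (rule nonneg)
      have "Re (F (dil \<rho> (pCons 0 p)) (dil \<rho> (pCons 0 p))) \<le> \<rho>\<^sup>2 * Re (F (dil \<rho> p) (dil \<rho> p))"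
        unfolding dil_shift by (rule shrink)
      also have "\<dots> \<le> 1 * Re (F (dil \<rho> p) (dil \<rho> p))"
        using \<rho> by (intro mult_right_mono nonneg) (simp add: power_le_one)
      finally show "Re (F (dil \<rho> (pCons 0 p)) (dil \<rho> (pCons 0 p))) \<le> Re (F (dil \<rho> p) (dil \<rho> p))"
        by simp
    qed
    define v where "v = Re (F (dil \<rho> s) (dil \<rho> s))"
    have v_le: "Re (F (dil \<rho> (monom 1 n * s)) (dil \<rho> (monom 1 n * s))) \<le> (\<rho>\<^sup>2) ^ n * v" for n
    proof (induction n)
      case 0
      then show ?case by (simp add: v_def monom_0)
    next
      case (Suc n)
      have "monom 1 (Suc n) * s = pCons 0 (monom 1 n * s)"
        by (simp add: monom_Suc)
      then have "Re (F (dil \<rho> (monom 1 (Suc n) * s)) (dil \<rho> (monom 1 (Suc n) * s)))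
          \<le> \<rho>\<^sup>2 * Re (F (dil \<rho> (monom 1 n * s)) (dil \<rho> (monom 1 n * s)))"
        using shrink by (simp only: dil_shift)
      also have "\<dots> \<le> \<rho>\<^sup>2 * ((\<rho>\<^sup>2) ^ n * v)"
        using Suc by (intro mult_left_mono) auto
      finally show ?case by simp
    qed
    have "(\<lambda>n. Re (F (dil \<rho> (monom 1 n * s)) (dil \<rho> (monom 1 n * s)))) \<longlonglongrightarrow> 0"
    proof (rule tendsto_sandwich[of "\<lambda>_. 0" _ _ "\<lambda>n. (\<rho>\<^sup>2) ^ n * v"])
      show "(\<lambda>n. (\<rho>\<^sup>2) ^ n * v) \<longlonglongrightarrow> 0"
        using \<rho> by (intro tendsto_mult_left_zero LIMSEQ_realpow_zero) (auto simp: power_less_one_iff)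
      show "(\<lambda>_. 0) \<longlonglongrightarrow> (0::real)" by (rule tendsto_const)
    qed (auto intro: v_le nonneg always_eventually)
    moreover have "cmod (poly s z) \<le> M" if "cmod z = 1" for z using M that by simp
    ultimately show ?thesis
      using G.von_neumann_decaying[of s M] by (simp add: dil_def pcompose_1)
  qed
  \<comment> \<open>This exhibits the value of the form as a polynomial in \<rho>, so the limit
    requires no continuity of \<open>F\<close>.\<close>
  have dil_sum: "dil \<rho> s = (\<Sum>i\<le>degree s. smult (of_real \<rho> ^ i) (monom (coeff s i) i))" for \<rho>
    by (rule poly_eqI)
       (auto simp: dil_def coeff_sum coeff_pcompose_linear if_distrib[of "\<lambda>x. _ * x"] not_le
         intro: coeff_eq_0 cong: if_cong)
  have F_dil: "F (dil \<rho> s) (dil \<rho> s) = (\<Sum>i\<le>degree s. \<Sum>j\<le>degree s.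
      of_real \<rho> ^ i * (of_real \<rho> ^ j * F (monom (coeff s i) i) (monom (coeff s j) j)))" for \<rho>
    unfolding dil_sum sum_left smult_left by (simp add: sum_right smult_right sum_distrib_left)
  have "((\<lambda>\<rho>. Re (F (dil \<rho> s) (dil \<rho> s))) \<longlongrightarrow> Re (F (dil 1 s) (dil 1 s))) (at_left 1)"
    unfolding F_dil by (intro tendsto_intros)
  moreover have "\<forall>\<^sub>F \<rho> in at_left (1::real). Re (F (dil \<rho> s) (dil \<rho> s)) \<le> M\<^sup>2 * Re (F 1 1)"
    unfolding eventually_at_left_field using bound by (intro exI[of _ 0]) auto
  ultimately have "Re (F (dil 1 s) (dil 1 s)) \<le> M\<^sup>2 * Re (F 1 1)"
    by (intro tendsto_upperbound) auto
  then show ?thesis by (simp add: dil_def)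
qed

text \<open>In norms: |u - \<alpha> w|^2 >= (|u| - |\<alpha>| |w|)^2 >= (1 - 2 |\<alpha>|) |u|^2
  when |w| <= |u|. The proof avoids square roots by using positivity at
  \<open>p - smult \<beta> w\<close> to bound the mixed term, where \<beta> is the phase of
  \<alpha>.\<close>

lemma perturbation_ge:
  assumes "Re (F w w) \<le> Re (F p p)"
  shows "(1 - 2 * cmod \<alpha>) * Re (F p p) \<le> Re (F (p - smult \<alpha> w) (p - smult \<alpha> w))"
proof -
  \<comment> \<open>For \<alpha> = 0 this is 0, so only \<open>cmod \<beta> \<le> 1\<close> holds
    and not equality.\<close>
  define \<beta> where "\<beta> = sgn \<alpha>"
  have \<alpha>: "\<alpha> = cmod \<alpha> * \<beta>"
    by (simp add: \<beta>_def sgn_eq)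
  have \<beta>: "cmod \<beta> \<le> 1" by (simp add: \<beta>_def norm_sgn)
  define x where "x = Re (F p (smult \<beta> w))"
  have expand: "Re (F (p - smult (of_real t * \<beta>) w) (p - smult (of_real t * \<beta>) w))
      = Re (F p p) - 2 * t * x + t\<^sup>2 * (cmod \<beta>)\<^sup>2 * Re (F w w)" for t
  proof -
    have "Re (F (smult \<beta> w) p) = x" unfolding x_def by (subst commute) simp
    moreover have "F (smult (of_real t * \<beta>) w) q = of_real t * F (smult \<beta> w) q"
      "F q (smult (of_real t * \<beta>) w) = of_real t * F q (smult \<beta> w)" for q
      by (simp_all add: smult_left smult_right)
    moreover have "F (smult \<beta> w) (smult \<beta> w) = of_real ((cmod \<beta>)\<^sup>2) * F w w"
      by (simp add: smult_both)
    ultimately show ?thesis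
      by (simp add: diff_left diff_right x_def power2_eq_square algebra_simps)
  qed
  have w\<beta>: "(cmod \<beta>)\<^sup>2 * Re (F w w) \<le> Re (F p p)"
  proof -
    have "(cmod \<beta>)\<^sup>2 * Re (F w w) \<le> 1 * Re (F w w)"
      using \<beta> by (intro mult_right_mono nonneg) (simp add: power_le_one)
    with assms show ?thesis by simp
  qed
  have "0 \<le> Re (F p p) - 2 * x + (cmod \<beta>)\<^sup>2 * Re (F w w)"
    using expand[of 1] nonneg by (metis mult_1 of_real_1 mult.right_neutral power_one)
  then have "x \<le> Re (F p p)" using w\<beta> by simp
  then have "cmod \<alpha> * x \<le> cmod \<alpha> * Re (F p p)" by (intro mult_left_mono) auto
  moreover have "Re (F (p - smult \<alpha> w) (p - smult \<alpha> w))
      = Re (F p p) - 2 * cmod \<alpha> * x + (cmod \<alpha>)\<^sup>2 * (cmod \<beta>)\<^sup>2 * Re (F w w)"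
    using expand[of "cmod \<alpha>"] \<alpha> by simp
  moreover have "0 \<le> (cmod \<alpha>)\<^sup>2 * (cmod \<beta>)\<^sup>2 * Re (F w w)" by (simp add: nonneg)
  ultimately show ?thesis by (simp add: algebra_simps)
qed

end

text \<open>Induction on the degree of the denominator. The numerator \<open>p\<close> need not be
  divisible by z - a, so it is first multiplied by 1 - (z/a)^n. Since |a| > 1, this factor is at
  most 1 + |1/a|^n on the disk and lowers the form by a factor of at least 1 - 2 |1/a|^n; both
  errors vanish as n grows.\<close>

theorem von_neumann_rational:
  assumes "contractive_form F"
    and "\<And>z. cmod z \<le> 1 \<Longrightarrow> cmod (poly p z) \<le> M * cmod (poly q z)"
    and "\<And>z. cmod z \<le> 1 \<Longrightarrow> poly q z \<noteq> 0"
  shows "Re (F p p) \<le> M\<^sup>2 * Re (F q q)"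
  using assms
proof (induction "degree q" arbitrary: F p M q)
  case 0
  then obtain c where q: "q = [:c:]" by (metis degree_eq_zeroE)
  interpret contractive_form F by fact
  have "Re (F p p) \<le> (M * cmod c)\<^sup>2 * Re (F 1 1)"
    using 0(3) q by (intro von_neumann_polynomial) simp
  also have "(M * cmod c)\<^sup>2 * Re (F 1 1) = M\<^sup>2 * Re (F q q)"
    using smult_both[of c 1] q by (simp add: power_mult_distrib flip: of_real_power)
  finally show ?case .
next
  case (Suc d)
  interpret contractive_form F by fact
  obtain a q' where q': "q = [:- a, 1:] * q'" and deg: "d = degree q'"
    using linear_factor Suc(2) by metis
  then have a: "poly q a = 0" by simp
  have a1: "cmod a > 1" using Suc.prems(3) a by (meson not_le)
  then have a0: "a \<noteq> 0" by auto
  define \<alpha> where "\<alpha> = inverse a"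
  have \<alpha>: "cmod \<alpha> < 1" using a1 by (simp add: \<alpha>_def norm_inverse inverse_less_1_iff)
  \<comment> \<open>The form of the vector (T - a) x: \<open>q'\<close> measured by it is
    \<open>q\<close> measured by \<open>F\<close>. It stays contractive because multiplication by z
    commutes with multiplication by z - a.\<close>
  interpret G: contractive_form "\<lambda>p q. F ([:- a, 1:] * p) ([:- a, 1:] * q)"
  proof
    fix p q r :: "complex poly" and b
    show "F ([:- a, 1:] * (p + q)) ([:- a, 1:] * r)
        = F ([:- a, 1:] * p) ([:- a, 1:] * r) + F ([:- a, 1:] * q) ([:- a, 1:] * r)"
      by (simp only: distrib_left add_left)
    show "F ([:- a, 1:] * smult b p) ([:- a, 1:] * q) = b * F ([:- a, 1:] * p) ([:- a, 1:] * q)"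
      by (simp only: mult_smult_right smult_left)
    show "F ([:- a, 1:] * q) ([:- a, 1:] * p) = cnj (F ([:- a, 1:] * p) ([:- a, 1:] * q))"
      by (rule commute)
    show "0 \<le> Re (F ([:- a, 1:] * p) ([:- a, 1:] * p))" by (rule nonneg)
    show "Re (F ([:- a, 1:] * pCons 0 p) ([:- a, 1:] * pCons 0 p)) \<le> Re (F ([:- a, 1:] * p) ([:- a, 1:] * p))"
      using shift_le[of "[:- a, 1:] * p"] by (simp only: mult_pCons_right smult_0_left add_0_left)
  qed
  have key: "(1 - 2 * cmod \<alpha> ^ n) * Re (F p p) \<le> (M * (1 + cmod \<alpha> ^ n))\<^sup>2 * Re (F q q)" for n
  proof -
    define h where "h = 1 - monom (\<alpha> ^ n) n"
    have "poly h a = 0" using a0 by (simp add: h_def poly_monom \<alpha>_def power_inverse)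
    then obtain g where g: "h = [:- a, 1:] * g" by (metis poly_eq_0_iff_dvd dvdE)
    have "Re (F ([:- a, 1:] * (p * g)) ([:- a, 1:] * (p * g)))
        \<le> (M * (1 + cmod \<alpha> ^ n))\<^sup>2 * Re (F ([:- a, 1:] * q') ([:- a, 1:] * q'))"
    proof (rule Suc.hyps(1)[OF deg G.contractive_form_axioms])
      fix z assume z: "cmod z \<le> 1"
      then show "poly q' z \<noteq> 0" using Suc.prems(3)[of z] q' by auto
      have za: "cmod (z - a) > 0" using z a1 by auto
      have "cmod (z - a) * cmod (poly (p * g) z) = cmod (poly p z) * cmod (poly h z)"
        by (simp add: g norm_mult) (simp add: norm_mult[symmetric] algebra_simps)
      also have "\<dots> \<le> (M * cmod (poly q z)) * (1 + cmod \<alpha> ^ n)"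
      proof (rule mult_mono)
        show "cmod (poly p z) \<le> M * cmod (poly q z)" using Suc.prems(2) z by blast
        then show "0 \<le> M * cmod (poly q z)" by (meson norm_ge_zero order_trans)
        have "cmod (poly h z) \<le> 1 + cmod \<alpha> ^ n * cmod z ^ n"
          using norm_triangle_ineq4[of 1 "\<alpha> ^ n * z ^ n"]
          by (simp add: h_def poly_monom norm_mult norm_power)
        also have "\<dots> \<le> 1 + cmod \<alpha> ^ n * 1"
          using z by (intro add_left_mono mult_left_mono) (auto simp: power_le_one)
        finally show "cmod (poly h z) \<le> 1 + cmod \<alpha> ^ n" by simp
      qed auto
      also have "\<dots> = cmod (z - a) * (M * (1 + cmod \<alpha> ^ n) * cmod (poly q' z))"
        by (simp add: q' norm_mult) (simp add: norm_mult[symmetric] algebra_simps)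
      finally show "cmod (poly (p * g) z) \<le> M * (1 + cmod \<alpha> ^ n) * cmod (poly q' z)"
        using za by (simp add: mult_le_cancel_left)
    qed
    moreover have "[:- a, 1:] * (p * g) = p - smult (\<alpha> ^ n) (monom 1 n * p)"
    proof -
      have "[:- a, 1:] * (p * g) = h * p" unfolding g by (simp only: mult_ac)
      also have "monom (\<alpha> ^ n) n = smult (\<alpha> ^ n) (monom 1 n)" by (simp add: smult_monom)
      then have "h * p = p - smult (\<alpha> ^ n) (monom 1 n * p)"
        by (simp add: h_def left_diff_distrib)
      finally show ?thesis .
    qed
    ultimately show ?thesis
      using perturbation_ge[OF monom_mult_le[of n p], of "\<alpha> ^ n"] q' by (simp add: norm_power)
  qed
  have lim: "(\<lambda>n. cmod \<alpha> ^ n) \<longlonglongrightarrow> 0" using \<alpha> by (intro LIMSEQ_realpow_zero) auto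
  have "(\<lambda>n. (1 - 2 * cmod \<alpha> ^ n) * Re (F p p)) \<longlonglongrightarrow> (1 - 2 * 0) * Re (F p p)"
    by (intro tendsto_intros lim)
  moreover have "(\<lambda>n. (M * (1 + cmod \<alpha> ^ n))\<^sup>2 * Re (F q q)) \<longlonglongrightarrow> (M * (1 + 0))\<^sup>2 * Re (F q q)"
    by (intro tendsto_intros lim)
  ultimately have "(1 - 2 * 0) * Re (F p p) \<le> (M * (1 + 0))\<^sup>2 * Re (F q q)"
    using key by (intro LIMSEQ_le) auto
  then show ?case by simp
qed

section \<open>Hilbert spaces\<close>

lemma complex_ring_simps [simp]:
  "carrier complex_ring = UNIV" "add complex_ring = (+)" "monoid.mult complex_ring = (*)"
  "\<zero>\<^bsub>complex_ring\<^esub> = 0" "\<one>\<^bsub>complex_ring\<^esub> = 1"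
  by (simp_all add: complex_ring_def)

context hilbert_space
begin

lemma scale_closed [simp, intro]: "x \<in> carrier H \<Longrightarrow> a \<odot> x \<in> carrier H"
  using smult_closed[of a x] by simp

lemma diff_closed [simp, intro]: "x \<in> carrier H \<Longrightarrow> y \<in> carrier H \<Longrightarrow> x \<ominus> y \<in> carrier H"
  by (rule M.minus_closed)

lemma scale_zero [simp]: "x \<in> carrier H \<Longrightarrow> 0 \<odot> x = \<zero>"
  using smult_l_null[of x] by simp

lemma scale_one [simp]: "x \<in> carrier H \<Longrightarrow> 1 \<odot> x = x"
  using smult_one[of x] by simp

lemma cinner_zero_left [simp]: "z \<in> carrier H \<Longrightarrow> cinner H \<zero> z = 0"
  using cinner_smult_left[of z z 0] by simp

lemma cinner_uminus_left: "x \<in> carrier H \<Longrightarrow> z \<in> carrier H \<Longrightarrow> cinner H (\<ominus> x) z = - cinner H x z"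
  using cinner_add_left[of "\<ominus> x" x z] by (simp add: M.l_neg eq_neg_iff_add_eq_0)

lemma cinner_diff_left:
  "x \<in> carrier H \<Longrightarrow> y \<in> carrier H \<Longrightarrow> z \<in> carrier H \<Longrightarrow> cinner H (x \<ominus> y) z = cinner H x z - cinner H y z"
  by (simp add: a_minus_def cinner_add_left cinner_uminus_left)

lemma cinner_zero_right [simp]: "z \<in> carrier H \<Longrightarrow> cinner H z \<zero> = 0"
  using cinner_commute[of "\<zero>" z] by simp

lemma cinner_add_right:
  "x \<in> carrier H \<Longrightarrow> y \<in> carrier H \<Longrightarrow> z \<in> carrier H \<Longrightarrow> cinner H z (x \<oplus> y) = cinner H z x + cinner H z y"
  using cinner_commute[of z] by (metis M.a_closed cinner_add_left cinner_commute complex_cnj_add)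

lemma cinner_smult_right:
  "x \<in> carrier H \<Longrightarrow> z \<in> carrier H \<Longrightarrow> cinner H z (a \<odot> x) = cnj a * cinner H z x"
  by (metis scale_closed cinner_smult_left cinner_commute complex_cnj_mult)

lemma cinner_uminus_right: "x \<in> carrier H \<Longrightarrow> z \<in> carrier H \<Longrightarrow> cinner H z (\<ominus> x) = - cinner H z x"
  by (metis M.a_inv_closed cinner_uminus_left cinner_commute complex_cnj_minus)

lemma cinner_diff_right:
  "x \<in> carrier H \<Longrightarrow> y \<in> carrier H \<Longrightarrow> z \<in> carrier H \<Longrightarrow> cinner H z (x \<ominus> y) = cinner H z x - cinner H z y"
  by (simp add: a_minus_def cinner_add_right cinner_uminus_right)

lemmas cinner_linear = cinner_add_left cinner_add_right cinner_diff_left cinner_diff_right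
  cinner_smult_left cinner_smult_right cinner_uminus_left cinner_uminus_right

lemma diff_eq_zeroD: "x \<in> carrier H \<Longrightarrow> y \<in> carrier H \<Longrightarrow> x \<ominus> y = \<zero> \<Longrightarrow> x = y"
  by (metis M.a_assoc M.a_inv_closed M.l_neg M.l_zero M.r_zero a_minus_def)

text \<open>The means by which vector identities are verified below: tested against an arbitrary
  \<open>z\<close> and expanded by \<open>cinner_linear\<close>, they become identities between
  complex numbers.\<close>

lemma cinner_eqI:
  assumes "x \<in> carrier H" "y \<in> carrier H" "\<And>z. z \<in> carrier H \<Longrightarrow> cinner H x z = cinner H y z"
  shows "x = y"
proof -
  have "cinner H (x \<ominus> y) (x \<ominus> y) = 0"
    using assms by (simp add: cinner_diff_left)
  then have "x \<ominus> y = \<zero>" using assms cinner_self_eq_zero by simp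
  then show ?thesis using assms by (simp add: diff_eq_zeroD)
qed

lemma cinner_self: "x \<in> carrier H \<Longrightarrow> cinner H x x = of_real ((hnorm H x)\<^sup>2)"
  using cinner_self_nonneg[of x] by (auto simp: hnorm_def elim!: nonneg_Reals_cases simp flip: of_real_power)

lemma hnorm_square: "x \<in> carrier H \<Longrightarrow> (hnorm H x)\<^sup>2 = Re (cinner H x x)"
  by (simp add: cinner_self)

lemma hnorm_nonneg [simp]: "x \<in> carrier H \<Longrightarrow> 0 \<le> hnorm H x"
  using cinner_self_nonneg[of x] by (auto simp: hnorm_def elim: nonneg_Reals_cases)

lemma hnorm_zero [simp]: "hnorm H \<zero> = 0"
  by (simp add: hnorm_def)

lemma hnorm_eq_zero: "x \<in> carrier H \<Longrightarrow> hnorm H x = 0 \<longleftrightarrow> x = \<zero>"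
  using cinner_self[of x] cinner_self_eq_zero[of x] by auto

lemma hnorm_scale: "x \<in> carrier H \<Longrightarrow> hnorm H (a \<odot> x) = cmod a * hnorm H x"
proof (rule power2_eq_imp_eq)
  assume x: "x \<in> carrier H"
  have "cinner H (a \<odot> x) (a \<odot> x) = (a * cnj a) * cinner H x x"
    using x by (simp add: cinner_linear)
  also have "\<dots> = of_real ((cmod a * hnorm H x)\<^sup>2)"
    by (simp only: cinner_self[OF x] complex_norm_square[symmetric] of_real_mult[symmetric] power_mult_distrib)
  finally show "(hnorm H (a \<odot> x))\<^sup>2 = (cmod a * hnorm H x)\<^sup>2"
    using x cinner_self[of "a \<odot> x"] by (simp only: scale_closed of_real_eq_iff)
qed auto

lemma hnorm_add_square:
  "x \<in> carrier H \<Longrightarrow> y \<in> carrier H \<Longrightarrow>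
   (hnorm H (x \<oplus> y))\<^sup>2 = (hnorm H x)\<^sup>2 + 2 * Re (cinner H x y) + (hnorm H y)\<^sup>2"
  using cinner_commute[of x y] by (simp add: hnorm_square cinner_linear)

lemma hnorm_diff_square:
  "x \<in> carrier H \<Longrightarrow> y \<in> carrier H \<Longrightarrow>
   (hnorm H (x \<ominus> y))\<^sup>2 = (hnorm H x)\<^sup>2 - 2 * Re (cinner H x y) + (hnorm H y)\<^sup>2"
  using cinner_commute[of x y] by (simp add: hnorm_square cinner_linear)

lemma Cauchy_Schwarz:
  assumes x: "x \<in> carrier H" and y: "y \<in> carrier H"
  shows "cmod (cinner H x y) \<le> hnorm H x * hnorm H y"
proof (cases "hnorm H y = 0")
  case True
  then show ?thesis using x y by (simp add: hnorm_eq_zero)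
next
  case False
  define c where "c = cinner H x y"
  define n where "n = (hnorm H y)\<^sup>2"
  have n: "n > 0" using False by (simp add: n_def)
  \<comment> \<open>The component of \<open>x\<close> orthogonal to \<open>y\<close>, multiplied by
    \<open>n\<close> to avoid a division.\<close>
  have "(hnorm H (of_real n \<odot> x \<ominus> c \<odot> y))\<^sup>2 = n * (n * (hnorm H x)\<^sup>2 - (cmod c)\<^sup>2)"
  proof -
    have "Re (cinner H (of_real n \<odot> x) (c \<odot> y)) = n * (cmod c)\<^sup>2"
      using x y by (simp add: cinner_linear c_def[symmetric] cmod_power2) (simp add: power2_eq_square algebra_simps)
    moreover have "(hnorm H (c \<odot> y))\<^sup>2 = n * (cmod c)\<^sup>2"
      using y by (simp add: hnorm_scale n_def power_mult_distrib)
    moreover have "(hnorm H (of_real n \<odot> x))\<^sup>2 = n\<^sup>2 * (hnorm H x)\<^sup>2"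
      using x by (simp add: hnorm_scale power_mult_distrib)
    ultimately show ?thesis
      using hnorm_diff_square[of "of_real n \<odot> x" "c \<odot> y"] x y by (simp add: algebra_simps power2_eq_square)
  qed
  then have "0 \<le> n * (n * (hnorm H x)\<^sup>2 - (cmod c)\<^sup>2)" by (metis zero_le_power2)
  then have "(cmod c)\<^sup>2 \<le> (hnorm H x * hnorm H y)\<^sup>2"
    using n by (simp add: zero_le_mult_iff n_def power_mult_distrib mult.commute)
  then show ?thesis using x y by (simp add: c_def power2_le_iff_abs_le)
qed

lemma hnorm_triangle:
  assumes x: "x \<in> carrier H" and y: "y \<in> carrier H"
  shows "hnorm H (x \<oplus> y) \<le> hnorm H x + hnorm H y"
proof (rule power2_le_imp_le)
  have "Re (cinner H x y) \<le> hnorm H x * hnorm H y"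
    using Cauchy_Schwarz[OF x y] complex_Re_le_cmod order_trans by blast
  then show "(hnorm H (x \<oplus> y))\<^sup>2 \<le> (hnorm H x + hnorm H y)\<^sup>2"
    using x y by (simp add: hnorm_add_square power2_sum)
qed (use x y in simp)

lemma hnorm_diff_triangle:
  assumes "x \<in> carrier H" "y \<in> carrier H"
  shows "hnorm H x \<le> hnorm H (x \<ominus> y) + hnorm H y"
proof -
  have "(x \<ominus> y) \<oplus> y = x" using assms by (intro cinner_eqI) (auto simp: cinner_linear)
  then show ?thesis using hnorm_triangle[of "x \<ominus> y" y] assms by simp
qed

lemma hnorm_diff_commute:
  assumes "x \<in> carrier H" "y \<in> carrier H"
  shows "hnorm H (x \<ominus> y) = hnorm H (y \<ominus> x)"
proof -
  have "x \<ominus> y = (-1) \<odot> (y \<ominus> x)" using assms by (intro cinner_eqI) (auto simp: cinner_linear)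
  then show ?thesis using assms by (simp add: hnorm_scale)
qed

text \<open>Needed because \<open>op_adjoint\<close> is a definite description, which has a meaning
  only once a representing vector exists.\<close>

theorem Riesz_representation:
  assumes add: "\<And>x y. x \<in> carrier H \<Longrightarrow> y \<in> carrier H \<Longrightarrow> \<phi> (x \<oplus> y) = \<phi> x + \<phi> y"
    and scale: "\<And>a x. x \<in> carrier H \<Longrightarrow> \<phi> (a \<odot> x) = a * \<phi> x"
    and bound: "\<And>x. x \<in> carrier H \<Longrightarrow> cmod (\<phi> x) \<le> K * hnorm H x"
  shows "\<exists>z\<in>carrier H. \<forall>x\<in>carrier H. \<phi> x = cinner H x z"
proof -
  \<comment> \<open>The representing vector is the minimiser of \<open>J\<close>, since \<open>J x = \<parallel>x - z\<parallel>\<^sup>2 - \<parallel>z\<parallel>\<^sup>2\<close> if \<open>z\<close> represents \<open>\<phi>\<close>.\<close>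
  define J where "J = (\<lambda>x. (hnorm H x)\<^sup>2 - 2 * Re (\<phi> x))"
  define m where "m = (INF x\<in>carrier H. J x)"
  have Re_bound: "\<bar>Re (\<phi> x)\<bar> \<le> K * hnorm H x" if "x \<in> carrier H" for x
    using bound[OF that] abs_Re_le_cmod order_trans by blast
  have J_ge: "- K\<^sup>2 \<le> J x" if x: "x \<in> carrier H" for x
  proof -
    have "0 \<le> (hnorm H x - K)\<^sup>2" by simp
    then have "2 * (K * hnorm H x) \<le> (hnorm H x)\<^sup>2 + K\<^sup>2" by (simp add: power2_diff algebra_simps)
    then show ?thesis using Re_bound[OF x] unfolding J_def by linarith
  qed
  then have bdd: "bdd_below (J ` carrier H)" by (auto intro!: bdd_belowI[of _ "- K\<^sup>2"])
  have m_le: "m \<le> J x" if "x \<in> carrier H" for x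
    unfolding m_def using bdd that by (rule cINF_lower)
  have "\<exists>x\<in>carrier H. J x < m + 1 / Suc n" for n
  proof -
    have "(INF x\<in>carrier H. J x) < m + 1 / Suc n" by (simp add: m_def)
    then show ?thesis using bdd by (subst (asm) cINF_less_iff) auto
  qed
  then obtain s where s: "\<And>n. s n \<in> carrier H" "\<And>n. J (s n) < m + 1 / Suc n" by metis
  \<comment> \<open>By the parallelogram law, two near-minimisers are close to each other since
    their midpoint cannot go below \<open>m\<close>. This makes \<open>s\<close> a Cauchy
    sequence.\<close>
  have midpoint: "(hnorm H (x \<ominus> y))\<^sup>2 \<le> 2 * (J x - m) + 2 * (J y - m)"
    if x: "x \<in> carrier H" and y: "y \<in> carrier H" for x y
  proof -
    have "m \<le> J ((1/2) \<odot> (x \<oplus> y))" using x y by (intro m_le) auto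
    also have "\<dots> = (hnorm H (x \<oplus> y))\<^sup>2 / 4 - Re (\<phi> x) - Re (\<phi> y)"
      using x y by (simp add: J_def hnorm_scale scale add power_divide add_divide_distrib)
    finally show ?thesis using x y
      by (simp add: hnorm_add_square hnorm_diff_square J_def field_simps)
  qed
  have "\<exists>N. \<forall>i\<ge>N. \<forall>j\<ge>N. hnorm H (s i \<ominus> s j) < e" if e: "e > 0" for e
  proof -
    obtain N where N: "4 / e\<^sup>2 < real (Suc N)" using reals_Archimedean2 by (metis lessI less_trans of_nat_less_iff)
    have "hnorm H (s i \<ominus> s j) < e" if "i \<ge> N" "j \<ge> N" for i j
    proof (rule power_less_imp_less_base)
      have "1 / Suc i \<le> 1 / Suc N" "1 / Suc j \<le> 1 / Suc N" using that by (auto simp: frac_le)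
      then have "(hnorm H (s i \<ominus> s j))\<^sup>2 < 4 * (1 / Suc N)"
        using midpoint[OF s(1) s(1), of i j] s(2)[of i] s(2)[of j] by argo
      also have "4 * (1 / Suc N) < e\<^sup>2" using N e by (simp add: field_simps)
      finally show "(hnorm H (s i \<ominus> s j))\<^sup>2 < e\<^sup>2" .
    qed (use e in simp)
    then show ?thesis by blast
  qed
  then obtain z where z: "z \<in> carrier H" and lim: "(\<lambda>n. hnorm H (s n \<ominus> z)) \<longlonglongrightarrow> 0"
    using complete[of s] s(1) by blast
  have "J z \<le> m"
  proof (rule LIMSEQ_le_const)
    have "(\<lambda>n. m + inverse (real (Suc n)) + 2 * (hnorm H z + K) * hnorm H (s n \<ominus> z)) \<longlonglongrightarrow> m + 0 + 2 * (hnorm H z + K) * 0"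
      by (intro tendsto_intros lim LIMSEQ_inverse_real_of_nat)
    then show "(\<lambda>n. m + inverse (real (Suc n)) + 2 * (hnorm H z + K) * hnorm H (s n \<ominus> z)) \<longlonglongrightarrow> m" by simp
    have "J z \<le> m + inverse (real (Suc n)) + 2 * (hnorm H z + K) * hnorm H (s n \<ominus> z)" for n
    proof -
      define d where "d = s n \<ominus> z"
      have d: "d \<in> carrier H" using s z by (simp add: d_def)
      have sn: "s n = z \<oplus> d" using s z by (intro cinner_eqI) (auto simp: d_def cinner_linear)
      have "J (s n) = J z + 2 * Re (cinner H z d) + (hnorm H d)\<^sup>2 - 2 * Re (\<phi> d)"
        using z d by (simp add: J_def sn hnorm_add_square add)
      moreover have "\<bar>Re (cinner H z d)\<bar> \<le> hnorm H z * hnorm H d"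
        using Cauchy_Schwarz[OF z d] abs_Re_le_cmod order_trans by blast
      moreover have "0 \<le> (hnorm H d)\<^sup>2" by simp
      ultimately have "J z \<le> J (s n) + 2 * (hnorm H z * hnorm H d) + 2 * (K * hnorm H d)"
        using Re_bound[OF d] by linarith
      then show ?thesis using s(2)[of n] by (simp add: d_def algebra_simps inverse_eq_divide)
    qed
    then show "\<exists>N. \<forall>n\<ge>N. J z \<le> m + inverse (real (Suc n)) + 2 * (hnorm H z + K) * hnorm H (s n \<ominus> z)" by blast
  qed
  have Re_eq: "Re (\<phi> x) = Re (cinner H x z)" if x: "x \<in> carrier H" for x
  proof (rule ccontr)
    define b where "b = Re (cinner H x z) - Re (\<phi> x)"
    \<comment> \<open>Essentially the minimiser of 2 t b + t^2 |x|^2; the added 1 keeps the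
      denominator positive.\<close>
    define t where "t = - b / ((hnorm H x)\<^sup>2 + 1)"
    assume "Re (\<phi> x) \<noteq> Re (cinner H x z)"
    then have b: "b \<noteq> 0" by (simp add: b_def)
    have pos: "(hnorm H x)\<^sup>2 + 1 > 0" by (simp add: add_nonneg_pos)
    have "Re (cinner H z x) = Re (cinner H x z)" using cinner_commute[of x z] x z by simp
    then have "J (z \<oplus> of_real t \<odot> x) = J z + 2 * t * b + t\<^sup>2 * (hnorm H x)\<^sup>2"
      using x z by (simp add: J_def hnorm_add_square add scale hnorm_scale cinner_linear b_def
          power_mult_distrib algebra_simps)
    moreover have "J z \<le> J (z \<oplus> of_real t \<odot> x)"
      using \<open>J z \<le> m\<close> m_le[of "z \<oplus> of_real t \<odot> x"] x z by simp
    ultimately have "0 \<le> 2 * t * b + t\<^sup>2 * (hnorm H x)\<^sup>2" by simp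
    also have "\<dots> = t * (2 * b + t * (hnorm H x)\<^sup>2)" by (simp add: power2_eq_square algebra_simps)
    also have "t * (hnorm H x)\<^sup>2 = - b - t"
      using pos by (simp add: t_def field_simps)
    also have "t * (2 * b + (- b - t)) = t * b - t\<^sup>2" by (simp add: power2_eq_square algebra_simps)
    also have "t * b = - (b\<^sup>2 / ((hnorm H x)\<^sup>2 + 1))" by (simp add: t_def power2_eq_square)
    finally have "b\<^sup>2 / ((hnorm H x)\<^sup>2 + 1) \<le> 0" using zero_le_power2[of t] by linarith
    then show False using b pos by (simp add: divide_le_0_iff)
  qed
  have "\<phi> x = cinner H x z" if x: "x \<in> carrier H" for x
    using Re_eq[OF x] Re_eq[of "\<i> \<odot> x"] x z by (simp add: complex_eq_iff scale cinner_linear)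
  then show ?thesis using z by blast
qed

end

section \<open>Bounded operators and polynomials in them\<close>

text \<open>Operators are functions on the whole type, while identities such as
  \<open>poly_op_pCons\<close> hold on the carrier only; boundedness has to be transferred along
  agreement there.\<close>

lemma bounded_ops_cong:
  assumes "hilbert_space H" "\<And>x. x \<in> carrier H \<Longrightarrow> S x = T x"
  shows "S \<in> bounded_ops H \<longleftrightarrow> T \<in> bounded_ops H"
proof -
  interpret hilbert_space H by fact
  show ?thesis using assms(2) by (auto simp: bounded_ops_def Pi_iff)
qed

context hilbert_space
begin

lemma bounded_opsD:
  assumes "T \<in> bounded_ops H"
  shows "x \<in> carrier H \<Longrightarrow> T x \<in> carrier H"
    "x \<in> carrier H \<Longrightarrow> y \<in> carrier H \<Longrightarrow> T (x \<oplus> y) = T x \<oplus> T y"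
    "x \<in> carrier H \<Longrightarrow> T (a \<odot> x) = a \<odot> T x"
  using assms by (auto simp: bounded_ops_def)

lemma bounded_ops_bound:
  assumes "T \<in> bounded_ops H"
  obtains K where "K \<ge> 0" "\<And>x. x \<in> carrier H \<Longrightarrow> hnorm H (T x) \<le> K * hnorm H x"
proof -
  obtain K where K: "\<And>x. x \<in> carrier H \<Longrightarrow> hnorm H (T x) \<le> K * hnorm H x"
    using assms unfolding bounded_ops_def by blast
  have "hnorm H (T x) \<le> max K 0 * hnorm H x" if "x \<in> carrier H" for x
    using K[OF that] that by (meson hnorm_nonneg max.cobounded1 mult_right_mono order_trans)
  then show ?thesis using that[of "max K 0"] by simp
qed

lemma bounded_opsI:
  assumes "\<And>x. x \<in> carrier H \<Longrightarrow> T x \<in> carrier H"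
    and "\<And>x y. x \<in> carrier H \<Longrightarrow> y \<in> carrier H \<Longrightarrow> T (x \<oplus> y) = T x \<oplus> T y"
    and "\<And>a x. x \<in> carrier H \<Longrightarrow> T (a \<odot> x) = a \<odot> T x"
    and "\<And>x. x \<in> carrier H \<Longrightarrow> hnorm H (T x) \<le> K * hnorm H x"
  shows "T \<in> bounded_ops H"
  using assms by (auto simp: bounded_ops_def intro!: exI[of _ K])

lemma bounded_ops_scale: "(\<lambda>x. a \<odot> x) \<in> bounded_ops H"
proof (rule bounded_opsI)
  fix x y b assume "x \<in> carrier H" "y \<in> carrier H"
  then show "a \<odot> (x \<oplus> y) = a \<odot> x \<oplus> a \<odot> y"
    by (intro cinner_eqI) (simp_all add: cinner_linear distrib_left)
next
  fix x b assume "x \<in> carrier H"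
  then show "a \<odot> (b \<odot> x) = b \<odot> (a \<odot> x)" "hnorm H (a \<odot> x) \<le> cmod a * hnorm H x"
    by (auto simp: cinner_linear hnorm_scale intro: cinner_eqI)
qed auto

lemma bounded_ops_compose:
  assumes S: "S \<in> bounded_ops H" and T: "T \<in> bounded_ops H"
  shows "(\<lambda>x. S (T x)) \<in> bounded_ops H"
proof -
  obtain K L where K: "K \<ge> 0" "\<And>x. x \<in> carrier H \<Longrightarrow> hnorm H (S x) \<le> K * hnorm H x"
    and L: "\<And>x. x \<in> carrier H \<Longrightarrow> hnorm H (T x) \<le> L * hnorm H x"
    using bounded_ops_bound[OF S] bounded_ops_bound[OF T] by metis
  have "hnorm H (S (T x)) \<le> (K * L) * hnorm H x" if "x \<in> carrier H" for x
    using K(2)[of "T x"] mult_left_mono[OF L[OF that] K(1)] that bounded_opsD[OF T]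
    by (simp add: mult.assoc)
  then show ?thesis
    by (intro bounded_opsI) (auto simp: bounded_opsD[OF S] bounded_opsD[OF T])
qed

lemma bounded_ops_add:
  assumes S: "S \<in> bounded_ops H" and T: "T \<in> bounded_ops H"
  shows "(\<lambda>x. S x \<oplus> T x) \<in> bounded_ops H"
proof -
  obtain K L where K: "\<And>x. x \<in> carrier H \<Longrightarrow> hnorm H (S x) \<le> K * hnorm H x"
    and L: "\<And>x. x \<in> carrier H \<Longrightarrow> hnorm H (T x) \<le> L * hnorm H x"
    using bounded_ops_bound[OF S] bounded_ops_bound[OF T] by metis
  have "hnorm H (S x \<oplus> T x) \<le> (K + L) * hnorm H x" if "x \<in> carrier H" for x
    using K[OF that] L[OF that] hnorm_triangle[of "S x" "T x"] that bounded_opsD[OF T] bounded_opsD[OF S]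
    by (simp add: distrib_right)
  note bound = this and closed = bounded_opsD(1)[OF S] bounded_opsD(1)[OF T]
  show ?thesis
  proof (rule bounded_opsI[OF _ _ _ bound])
    fix x y a assume "x \<in> carrier H" "y \<in> carrier H"
    then show "S (x \<oplus> y) \<oplus> T (x \<oplus> y) = (S x \<oplus> T x) \<oplus> (S y \<oplus> T y)"
      using closed
      by (intro cinner_eqI) (simp_all add: bounded_opsD(2)[OF S] bounded_opsD(2)[OF T] cinner_linear)
  next
    fix x a assume "x \<in> carrier H"
    then show "S (a \<odot> x) \<oplus> T (a \<odot> x) = a \<odot> (S x \<oplus> T x)"
      using closed
      by (intro cinner_eqI) (simp_all add: bounded_opsD(3)[OF S] bounded_opsD(3)[OF T] cinner_linear distrib_left)
  qed (use closed in auto)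
qed

section \<open>Polynomials in an operator and von Neumann's inequality\<close>

lemma funpow_closed: "T \<in> carrier H \<rightarrow> carrier H \<Longrightarrow> x \<in> carrier H \<Longrightarrow> (T ^^ i) x \<in> carrier H"
  by (induction i) auto

lemma poly_op_closed:
  assumes "T \<in> bounded_ops H" "x \<in> carrier H"
  shows "poly_op H p T x \<in> carrier H"
  using assms unfolding poly_op_def
  by (intro M.finsum_closed) (auto intro!: funpow_closed simp: bounded_ops_def)

lemma cinner_finsum_left:
  assumes "finite A" "\<And>i. i \<in> A \<Longrightarrow> f i \<in> carrier H" "z \<in> carrier H"
  shows "cinner H (\<Oplus>\<^bsub>H\<^esub>i\<in>A. f i) z = (\<Sum>i\<in>A. cinner H (f i) z)"
  using assms by (induction A rule: finite_induct) (auto simp: cinner_linear Pi_def)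

lemma cinner_poly_op:
  assumes "T \<in> bounded_ops H" "x \<in> carrier H" "z \<in> carrier H"
  shows "cinner H (poly_op H p T x) z = (\<Sum>i\<le>degree p. coeff p i * cinner H ((T ^^ i) x) z)"
proof -
  have "(T ^^ i) x \<in> carrier H" for i
    using assms by (intro funpow_closed) (auto simp: bounded_ops_def)
  then show ?thesis
    unfolding poly_op_def using assms by (subst cinner_finsum_left) (auto simp: cinner_linear)
qed

lemma poly_op_0:
  assumes "T \<in> bounded_ops H" "x \<in> carrier H"
  shows "poly_op H 0 T x = \<zero>"
  using assms by (intro cinner_eqI) (auto simp: cinner_poly_op intro!: poly_op_closed)

text \<open>The Horner recursion. The homomorphism properties of the calculus follow from it by
  induction on polynomials, without returning to finite sums in the module.\<close>

lemma poly_op_pCons: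
  assumes T: "T \<in> bounded_ops H" and x: "x \<in> carrier H"
  shows "poly_op H (pCons a p) T x = a \<odot> x \<oplus> poly_op H p T (T x)"
proof (rule cinner_eqI)
  note closed = poly_op_closed[OF T] bounded_opsD(1)[OF T]
  show "poly_op H (pCons a p) T x \<in> carrier H" "a \<odot> x \<oplus> poly_op H p T (T x) \<in> carrier H"
    using x by (simp_all add: closed)
  fix z assume z: "z \<in> carrier H"
  have "(\<Sum>i\<le>degree (pCons a p). coeff (pCons a p) i * cinner H ((T ^^ i) x) z)
      = a * cinner H x z + (\<Sum>i\<le>degree p. coeff p i * cinner H ((T ^^ i) (T x)) z)"
    by (cases "p = 0") (simp_all add: sum.atMost_Suc_shift funpow_Suc_right del: sum.atMost_Suc funpow.simps)
  then show "cinner H (poly_op H (pCons a p) T x) z = cinner H (a \<odot> x \<oplus> poly_op H p T (T x)) z"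
    using x z by (simp add: cinner_linear cinner_poly_op[OF T] closed)
qed

lemma poly_op_bounded:
  assumes T: "T \<in> bounded_ops H"
  shows "poly_op H p T \<in> bounded_ops H"
proof (induction p)
  case 0
  have "poly_op H 0 T \<in> bounded_ops H \<longleftrightarrow> (\<lambda>x. 0 \<odot> x) \<in> bounded_ops H"
    by (rule bounded_ops_cong[OF hilbert_space_axioms]) (simp add: poly_op_0[OF T])
  then show ?case by (simp only: bounded_ops_scale)
next
  case (pCons a p)
  have "poly_op H (pCons a p) T \<in> bounded_ops H \<longleftrightarrow> (\<lambda>x. a \<odot> x \<oplus> poly_op H p T (T x)) \<in> bounded_ops H"
    by (rule bounded_ops_cong[OF hilbert_space_axioms]) (simp add: poly_op_pCons[OF T])
  then show ?case
    by (simp only: bounded_ops_add[OF bounded_ops_scale bounded_ops_compose[OF pCons(2) T]])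
qed

lemma poly_op_add:
  assumes T: "T \<in> bounded_ops H" and x: "x \<in> carrier H"
  shows "poly_op H (p + q) T x = poly_op H p T x \<oplus> poly_op H q T x"
  using x
proof (induction p q arbitrary: x rule: poly_induct2)
  case 0
  then show ?case by (simp add: poly_op_0[OF T])
next
  case (pCons a p b q)
  note closed = poly_op_closed[OF T] bounded_opsD(1)[OF T]
  show ?case unfolding add_pCons
    using pCons closed
    by (intro cinner_eqI) (simp_all add: poly_op_pCons[OF T] cinner_linear distrib_left distrib_right)
qed

lemma poly_op_smult:
  assumes T: "T \<in> bounded_ops H" and x: "x \<in> carrier H"
  shows "poly_op H (smult c p) T x = c \<odot> poly_op H p T x"
  using x
proof (induction p arbitrary: x)
  case 0
  then show ?case by (auto simp: poly_op_0[OF T] intro!: cinner_eqI simp: cinner_linear)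
next
  case (pCons a p)
  note closed = poly_op_closed[OF T] bounded_opsD(1)[OF T]
  show ?case unfolding smult_pCons
    using pCons closed
    by (intro cinner_eqI) (simp_all add: poly_op_pCons[OF T] cinner_linear distrib_left distrib_right)
qed

lemma poly_op_commute:
  assumes T: "T \<in> bounded_ops H" and x: "x \<in> carrier H"
  shows "T (poly_op H p T x) = poly_op H p T (T x)"
  using x
proof (induction p arbitrary: x)
  case 0
  then show ?case
    using bounded_opsD(3)[OF T, of x 0] by (simp add: poly_op_0[OF T] bounded_opsD[OF T])
next
  case (pCons a p)
  then show ?case by (simp add: poly_op_pCons[OF T] bounded_opsD[OF T] poly_op_closed[OF T])
qed

lemma poly_op_pCons_0:
  assumes T: "T \<in> bounded_ops H" and x: "x \<in> carrier H"
  shows "poly_op H (pCons 0 p) T x = T (poly_op H p T x)"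
  using assms by (simp add: poly_op_pCons poly_op_commute poly_op_closed bounded_opsD)

lemma poly_op_mult:
  assumes T: "T \<in> bounded_ops H" and x: "x \<in> carrier H"
  shows "poly_op H (p * q) T x = poly_op H p T (poly_op H q T x)"
proof (induction p)
  case 0
  then show ?case using x by (simp add: poly_op_0[OF T] poly_op_closed[OF T])
next
  case (pCons a p)
  have "poly_op H (pCons a p * q) T x = a \<odot> poly_op H q T x \<oplus> T (poly_op H (p * q) T x)"
    unfolding mult_pCons_left
    using x by (simp add: poly_op_add[OF T] poly_op_smult[OF T] poly_op_pCons_0[OF T])
  also have "\<dots> = poly_op H (pCons a p) T (poly_op H q T x)"
    unfolding pCons(2) using x by (simp add: poly_op_pCons[OF T] poly_op_closed[OF T] poly_op_commute[OF T])
  finally show ?case .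
qed

lemma poly_op_const:
  assumes T: "T \<in> bounded_ops H" and x: "x \<in> carrier H"
  shows "poly_op H [:c:] T x = c \<odot> x"
  using assms by (simp add: poly_op_pCons poly_op_0 bounded_opsD)

lemma poly_op_linear:
  assumes T: "T \<in> bounded_ops H" and x: "x \<in> carrier H"
  shows "poly_op H [:- a, 1:] T x = T x \<ominus> a \<odot> x"
  using assms
  by (intro cinner_eqI) (auto simp: poly_op_pCons poly_op_0 bounded_opsD cinner_linear)

lemma contractive_form_poly_op:
  assumes T: "T \<in> bounded_ops H" and x: "x \<in> carrier H"
    and contr: "\<And>y. y \<in> carrier H \<Longrightarrow> hnorm H (T y) \<le> hnorm H y"
  shows "contractive_form (\<lambda>p q. cinner H (poly_op H p T x) (poly_op H q T x))"
proof
  fix p q s :: "complex poly" and a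
  note [simp] = x poly_op_closed[OF T x] poly_op_add[OF T x] poly_op_smult[OF T x]
    poly_op_pCons_0[OF T x]
  show "cinner H (poly_op H (p + q) T x) (poly_op H s T x)
      = cinner H (poly_op H p T x) (poly_op H s T x) + cinner H (poly_op H q T x) (poly_op H s T x)"
    by (simp add: cinner_linear)
  show "cinner H (poly_op H (smult a p) T x) (poly_op H q T x)
      = a * cinner H (poly_op H p T x) (poly_op H q T x)"
    by (simp add: cinner_linear)
  show "cinner H (poly_op H q T x) (poly_op H p T x) = cnj (cinner H (poly_op H p T x) (poly_op H q T x))"
    by (rule cinner_commute) simp_all
  show "0 \<le> Re (cinner H (poly_op H p T x) (poly_op H p T x))"
    by (simp flip: hnorm_square)
  show "Re (cinner H (poly_op H (pCons 0 p) T x) (poly_op H (pCons 0 p) T x))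
      \<le> Re (cinner H (poly_op H p T x) (poly_op H p T x))"
    using contr[of "poly_op H p T x"] bounded_opsD[OF T] by (simp add: power_mono flip: hnorm_square)
qed

text \<open>Comparing p(T) x with q(T) x keeps inverses out of the statement; substituting the
  preimage of a vector under q(T) for \<open>x\<close> gives the bound for the rational
  function.\<close>

theorem von_neumann_inequality:
  assumes T: "T \<in> bounded_ops H" and x: "x \<in> carrier H"
    and contr: "\<And>y. y \<in> carrier H \<Longrightarrow> hnorm H (T y) \<le> hnorm H y"
    and le: "\<And>z. cmod z \<le> 1 \<Longrightarrow> cmod (poly p z) \<le> M * cmod (poly q z)"
    and nz: "\<And>z. cmod z \<le> 1 \<Longrightarrow> poly q z \<noteq> 0"
  shows "hnorm H (poly_op H p T x) \<le> M * hnorm H (poly_op H q T x)"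
proof (rule power2_le_imp_le)
  have "0 \<le> cmod (poly p 0)" by simp
  also have "\<dots> \<le> M * cmod (poly q 0)" by (rule le) simp
  finally have "0 \<le> M * cmod (poly q 0)" .
  then have "0 \<le> M" using nz[of 0] by (simp add: zero_le_mult_iff)
  then show "0 \<le> M * hnorm H (poly_op H q T x)" by (simp add: poly_op_closed[OF T x])
  show "(hnorm H (poly_op H p T x))\<^sup>2 \<le> (M * hnorm H (poly_op H q T x))\<^sup>2"
    using von_neumann_rational[OF contractive_form_poly_op[OF T x contr] le nz]
    by (simp add: power_mult_distrib hnorm_square poly_op_closed[OF T x])
qed

lemma bounded_ops_diff:
  assumes T: "T \<in> bounded_ops H" and "x \<in> carrier H" "y \<in> carrier H"
  shows "T (x \<ominus> y) = T x \<ominus> T y"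
proof -
  have "x \<ominus> y = x \<oplus> (-1) \<odot> y"
    using assms by (intro cinner_eqI) (simp_all add: cinner_linear)
  then have "T (x \<ominus> y) = T x \<oplus> (-1) \<odot> T y"
    using assms by (simp add: bounded_opsD[OF T])
  also have "\<dots> = T x \<ominus> T y"
    using assms bounded_opsD(1)[OF T] by (intro cinner_eqI) (simp_all add: cinner_linear)
  finally show ?thesis .
qed

section \<open>Invertibility and the spectrum of a contraction\<close>

lemma op_invertible_cong:
  assumes "\<And>x. x \<in> carrier H \<Longrightarrow> S x = T x"
  shows "op_invertible H S \<longleftrightarrow> op_invertible H T"
  using assms by (auto simp: op_invertible_def bounded_opsD(1))

lemma op_invertible_compose:
  assumes S: "op_invertible H S" and T: "op_invertible H T" "T \<in> bounded_ops H"
  shows "op_invertible H (\<lambda>x. S (T x))"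
proof -
  obtain S' where S': "S' \<in> bounded_ops H" "\<And>x. x \<in> carrier H \<Longrightarrow> S' (S x) = x \<and> S (S' x) = x"
    using S by (auto simp: op_invertible_def)
  obtain T' where T': "T' \<in> bounded_ops H" "\<And>x. x \<in> carrier H \<Longrightarrow> T' (T x) = x \<and> T (T' x) = x"
    using T by (auto simp: op_invertible_def)
  show ?thesis
    unfolding op_invertible_def
    using S' T' T(2) by (intro bexI[OF _ bounded_ops_compose[OF T'(1) S'(1)]]) (simp add: bounded_opsD(1))
qed

lemma op_invertible_scale:
  assumes "c \<noteq> 0"
  shows "op_invertible H (\<lambda>x. c \<odot> x)"
proof -
  have "inverse c \<odot> (c \<odot> x) = x \<and> c \<odot> (inverse c \<odot> x) = x" if "x \<in> carrier H" for x
    using that assms by (auto simp: cinner_linear intro!: cinner_eqI)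
  then show ?thesis
    unfolding op_invertible_def by (intro bexI[OF _ bounded_ops_scale[of "inverse c"]]) simp
qed

text \<open>Over the complex numbers q(T) is a nonzero constant times a product of factors T - a
  with \<open>a\<close> a root of \<open>q\<close>, and no such \<open>a\<close> lies in the
  spectrum.\<close>

lemma op_invertible_poly_op:
  assumes T: "T \<in> bounded_ops H"
    and "q \<noteq> 0" and "\<And>z. z \<in> op_spectrum H T \<Longrightarrow> poly q z \<noteq> 0"
  shows "op_invertible H (poly_op H q T)"
  using assms(2,3)
proof (induction "degree q" arbitrary: q)
  case 0
  then obtain c where c: "q = [:c:]" by (metis degree_eq_zeroE)
  then have "op_invertible H (poly_op H q T) \<longleftrightarrow> op_invertible H (\<lambda>x. c \<odot> x)"
    by (intro op_invertible_cong) (simp add: poly_op_const[OF T])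
  then show ?case using op_invertible_scale[of c] 0 c by simp
next
  case (Suc d)
  obtain a q' where q': "q = [:- a, 1:] * q'" and deg: "d = degree q'"
    using linear_factor Suc(2) by metis
  then have a: "poly q a = 0" by simp
  have "q' \<noteq> 0" using q' Suc.prems(1) by auto
  have inv': "op_invertible H (poly_op H q' T)"
    using Suc.prems(2) q' \<open>q' \<noteq> 0\<close> by (intro Suc.hyps(1)[OF deg]) auto
  have "a \<notin> op_spectrum H T" using a Suc.prems(2) by blast
  then have "op_invertible H (\<lambda>x. T x \<ominus> a \<odot> x)" by (simp add: op_spectrum_def)
  then have "op_invertible H (\<lambda>x. T (poly_op H q' T x) \<ominus> a \<odot> poly_op H q' T x)"
    by (rule op_invertible_compose[OF _ inv' poly_op_bounded[OF T]])
  moreover have "poly_op H q T x = T (poly_op H q' T x) \<ominus> a \<odot> poly_op H q' T x"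
    if "x \<in> carrier H" for x
    unfolding q' using that T by (simp only: poly_op_mult poly_op_linear poly_op_closed)
  ultimately show ?case by (subst op_invertible_cong)
qed

text \<open>Identifies the choice function inside \<open>rat_op\<close> with the bounded inverse on
  the carrier.\<close>

lemma op_invertible_inv_into:
  assumes "op_invertible H T" "T \<in> bounded_ops H"
  shows "inv_into (carrier H) T \<in> bounded_ops H"
    and "x \<in> carrier H \<Longrightarrow> T (inv_into (carrier H) T x) = x"
    and "x \<in> carrier H \<Longrightarrow> inv_into (carrier H) T (T x) = x"
proof -
  obtain S where S: "S \<in> bounded_ops H" "\<And>x. x \<in> carrier H \<Longrightarrow> S (T x) = x \<and> T (S x) = x"
    using assms by (auto simp: op_invertible_def)
  have inj: "inj_on T (carrier H)" by (rule inj_on_inverseI[of _ S]) (use S in auto)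
  have eq: "inv_into (carrier H) T x = S x" if "x \<in> carrier H" for x
    using inv_into_f_f[OF inj, of "S x"] S that bounded_opsD(1)[OF S(1)] by simp
  have "inv_into (carrier H) T \<in> bounded_ops H \<longleftrightarrow> S \<in> bounded_ops H"
    by (rule bounded_ops_cong[OF hilbert_space_axioms eq])
  then show "inv_into (carrier H) T \<in> bounded_ops H" using S(1) by simp
  show "x \<in> carrier H \<Longrightarrow> T (inv_into (carrier H) T x) = x"
    and "x \<in> carrier H \<Longrightarrow> inv_into (carrier H) T (T x) = x"
    using bounded_opsD(1)[OF assms(2)] by (simp_all add: eq S(2))
qed

text \<open>Boundedness below pulls the Cauchy property of the images back to \<open>s\<close>,
  completeness supplies a limit, and continuity of \<open>T\<close> sends it to \<open>x\<close>. In
  short, the range is closed.\<close>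

lemma limit_in_range:
  assumes T: "T \<in> bounded_ops H" and k: "k > 0"
    and below: "\<And>v. v \<in> carrier H \<Longrightarrow> k * hnorm H v \<le> hnorm H (T v)"
    and s: "\<And>n. s n \<in> carrier H" and x: "x \<in> carrier H"
    and lim: "(\<lambda>n::nat. hnorm H (T (s n) \<ominus> x)) \<longlonglongrightarrow> 0"
  shows "\<exists>y\<in>carrier H. T y = x"
proof -
  note closed = bounded_opsD(1)[OF T]
  have "\<exists>N. \<forall>m\<ge>N. \<forall>n\<ge>N. hnorm H (s m \<ominus> s n) < e" if e: "e > 0" for e
  proof -
    have "\<forall>\<^sub>F n in sequentially. hnorm H (T (s n) \<ominus> x) < k * e / 2"
      using order_tendstoD(2)[OF lim, of "k * e / 2"] k e by simp
    then obtain N where N: "\<And>n. n \<ge> N \<Longrightarrow> hnorm H (T (s n) \<ominus> x) < k * e / 2"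
      by (auto simp: eventually_sequentially)
    have "hnorm H (s m \<ominus> s n) < e" if "m \<ge> N" "n \<ge> N" for m n
    proof -
      have "k * hnorm H (s m \<ominus> s n) \<le> hnorm H (T (s m) \<ominus> T (s n))"
        using below[of "s m \<ominus> s n"] s by (simp add: bounded_ops_diff[OF T])
      also have "T (s m) \<ominus> T (s n) = (T (s m) \<ominus> x) \<oplus> (x \<ominus> T (s n))"
        using s x closed by (intro cinner_eqI) (simp_all add: cinner_linear)
      also have "hnorm H \<dots> \<le> hnorm H (T (s m) \<ominus> x) + hnorm H (x \<ominus> T (s n))"
        using s x closed by (intro hnorm_triangle) simp_all
      also have "\<dots> < k * e"
        using N[OF that(1)] N[OF that(2)] hnorm_diff_commute[of x "T (s n)"] s x closed by simp
      finally show ?thesis using k by simp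
    qed
    then show ?thesis by blast
  qed
  then obtain y where y: "y \<in> carrier H" and sy: "(\<lambda>n. hnorm H (s n \<ominus> y)) \<longlonglongrightarrow> 0"
    using complete[of s] s by blast
  obtain K where K: "\<And>v. v \<in> carrier H \<Longrightarrow> hnorm H (T v) \<le> K * hnorm H v"
    using bounded_ops_bound[OF T] by metis
  have "hnorm H (T y \<ominus> x) \<le> K * hnorm H (s n \<ominus> y) + hnorm H (T (s n) \<ominus> x)" for n
  proof -
    have "T y \<ominus> x = T (y \<ominus> s n) \<oplus> (T (s n) \<ominus> x)"
      using s x y closed by (intro cinner_eqI) (simp_all add: cinner_linear bounded_ops_diff[OF T])
    then have "hnorm H (T y \<ominus> x) \<le> hnorm H (T (y \<ominus> s n)) + hnorm H (T (s n) \<ominus> x)"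
      using hnorm_triangle s x y closed by simp
    also have "hnorm H (T (y \<ominus> s n)) \<le> K * hnorm H (s n \<ominus> y)"
      using K[of "y \<ominus> s n"] hnorm_diff_commute[of y "s n"] s y by simp
    finally show ?thesis by simp
  qed
  moreover have "(\<lambda>n. K * hnorm H (s n \<ominus> y) + hnorm H (T (s n) \<ominus> x)) \<longlonglongrightarrow> K * 0 + 0"
    by (intro tendsto_intros lim sy)
  ultimately have "hnorm H (T y \<ominus> x) \<le> K * 0 + 0" by (intro LIMSEQ_le_const) auto
  then have "hnorm H (T y \<ominus> x) = 0" using x y closed by (intro antisym) simp_all
  then have "T y = x" using x y closed by (simp add: hnorm_eq_zero diff_eq_zeroD)
  then show ?thesis using y by blast
qed

lemma op_invertibleI:
  assumes T: "T \<in> bounded_ops H" and k: "k > 0"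
    and below: "\<And>v. v \<in> carrier H \<Longrightarrow> k * hnorm H v \<le> hnorm H (T v)"
    and surj: "\<And>x. x \<in> carrier H \<Longrightarrow> \<exists>y\<in>carrier H. T y = x"
  shows "op_invertible H T"
proof -
  note closed = bounded_opsD(1)[OF T]
  have inj: "inj_on T (carrier H)"
  proof (rule inj_onI)
    fix x y assume xy: "x \<in> carrier H" "y \<in> carrier H" "T x = T y"
    then have "T (x \<ominus> y) = \<zero>"
      using closed by (simp add: bounded_ops_diff[OF T]) (intro cinner_eqI, simp_all add: cinner_linear)
    then have "k * hnorm H (x \<ominus> y) \<le> 0" using below[of "x \<ominus> y"] xy by simp
    then have "hnorm H (x \<ominus> y) = 0" using k xy by (intro antisym) (simp_all add: mult_le_0_iff)
    then show "x = y" using xy by (simp add: hnorm_eq_zero diff_eq_zeroD)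
  qed
  obtain S where S: "\<And>x. x \<in> carrier H \<Longrightarrow> S x \<in> carrier H \<and> T (S x) = x"
    using surj by metis
  have ST: "S (T x) = x" if "x \<in> carrier H" for x
    using inj_onD[OF inj, of "S (T x)" x] S closed that by simp
  have S_eqI: "S y = x" if "x \<in> carrier H" "T x = y" for x y using ST that by blast
  have "S \<in> bounded_ops H"
  proof (rule bounded_opsI[of _ "1 / k"])
    fix x y assume xy: "x \<in> carrier H" "y \<in> carrier H"
    show "S (x \<oplus> y) = S x \<oplus> S y" using S xy by (intro S_eqI) (auto simp: bounded_opsD[OF T])
    show "S (a \<odot> x) = a \<odot> S x" for a using S xy by (intro S_eqI) (auto simp: bounded_opsD[OF T])
    show "S x \<in> carrier H" using S xy by blast
    show "hnorm H (S x) \<le> 1 / k * hnorm H x" using below[of "S x"] S xy k by (simp add: field_simps)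
  qed
  then show ?thesis using S ST by (auto simp: op_invertible_def)
qed

text \<open>For |l| > 1 the operator T - l is bounded below by |l| - 1, so its range is closed;
  approximate preimages of every vector make it everything.\<close>

lemma spectrum_contraction:
  assumes T: "T \<in> bounded_ops H"
    and contr: "\<And>x. x \<in> carrier H \<Longrightarrow> hnorm H (T x) \<le> hnorm H x"
  shows "op_spectrum H T \<subseteq> cball 0 1"
proof (rule subsetI, rule ccontr)
  fix l assume l: "l \<in> op_spectrum H T" "l \<notin> cball 0 1"
  then have l1: "cmod l > 1" by simp
  then have "l \<noteq> 0" by auto
  define A where "A = (\<lambda>x. T x \<ominus> l \<odot> x)"
  note closed = bounded_opsD(1)[OF T] poly_op_closed[OF T]
  have A_poly: "poly_op H [:- l, 1:] T x = A x" if "x \<in> carrier H" for x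
    using that by (simp only: A_def poly_op_linear[OF T])
  have "poly_op H [:- l, 1:] T \<in> bounded_ops H \<longleftrightarrow> A \<in> bounded_ops H"
    by (rule bounded_ops_cong[OF hilbert_space_axioms A_poly])
  then have A: "A \<in> bounded_ops H" using poly_op_bounded[OF T] by simp
  have below: "(cmod l - 1) * hnorm H v \<le> hnorm H (A v)" if v: "v \<in> carrier H" for v
  proof -
    have "hnorm H (l \<odot> v) \<le> hnorm H (l \<odot> v \<ominus> T v) + hnorm H (T v)"
      using v closed by (intro hnorm_diff_triangle) auto
    also have "hnorm H (l \<odot> v \<ominus> T v) = hnorm H (A v)"
      unfolding A_def using v closed by (intro hnorm_diff_commute) auto
    finally show ?thesis using contr[OF v] v by (simp add: hnorm_scale algebra_simps)
  qed
  have "\<exists>y\<in>carrier H. A y = x" if x: "x \<in> carrier H" for x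
  proof -
    define \<alpha> where "\<alpha> = inverse l"
    \<comment> \<open>These quotients are the partial sums of the Neumann series for the inverse of
      T - l; the error after n terms is (T/l)^n x, of norm at most |1/l|^n |x|.\<close>
    define g where "g = (\<lambda>n. (1 - monom (\<alpha> ^ n) n) div [:- l, 1:])"
    have g: "[:- l, 1:] * g n = 1 - monom (\<alpha> ^ n) n" for n
    proof -
      have "poly (1 - monom (\<alpha> ^ n) n) l = 0"
        using \<open>l \<noteq> 0\<close> by (simp add: poly_monom \<alpha>_def power_inverse)
      then have "[:- l, 1:] dvd 1 - monom (\<alpha> ^ n) n" by (simp only: poly_eq_0_iff_dvd)
      then show ?thesis unfolding g_def by (rule dvd_mult_div_cancel)
    qed
    have "A (poly_op H (g n) T x) = x \<ominus> \<alpha> ^ n \<odot> poly_op H (monom 1 n) T x" for n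
    proof -
      have "A (poly_op H (g n) T x) = poly_op H (1 - monom (\<alpha> ^ n) n) T x"
        using x by (simp only: closed A_poly[symmetric] poly_op_mult[OF T, symmetric] g)
      also have "1 - monom (\<alpha> ^ n) n = [:1:] + smult (- (\<alpha> ^ n)) (monom 1 n)"
        by (simp add: smult_monom minus_monom one_pCons flip: diff_conv_add_uminus)
      also have "poly_op H \<dots> T x = 1 \<odot> x \<oplus> (- (\<alpha> ^ n)) \<odot> poly_op H (monom 1 n) T x"
        using x by (simp only: poly_op_add[OF T] poly_op_smult[OF T] poly_op_const[OF T])
      also have "\<dots> = x \<ominus> \<alpha> ^ n \<odot> poly_op H (monom 1 n) T x"
        using x closed by (intro cinner_eqI) (simp_all add: cinner_linear)
      finally show ?thesis .
    qed
    then have bound: "hnorm H (A (poly_op H (g n) T x) \<ominus> x) \<le> cmod \<alpha> ^ n * hnorm H x" for n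
    proof -
      have "A (poly_op H (g n) T x) \<ominus> x = (- (\<alpha> ^ n)) \<odot> poly_op H (monom 1 n) T x"
        unfolding \<open>A (poly_op H (g n) T x) = x \<ominus> \<alpha> ^ n \<odot> poly_op H (monom 1 n) T x\<close>
        using x closed by (intro cinner_eqI) (simp_all add: cinner_linear)
      moreover have "hnorm H (poly_op H (monom 1 n) T x) \<le> hnorm H x"
      proof (induction n)
        case 0
        then show ?case using x by (simp add: monom_0 poly_op_const[OF T])
      next
        case (Suc n)
        then show ?case
          using x contr[of "poly_op H (monom 1 n) T x"] closed
          by (simp add: monom_Suc poly_op_pCons_0[OF T])
      qed
      ultimately show ?thesis
        using x closed by (simp add: hnorm_scale norm_power mult_left_mono)
    qed
    show ?thesis
    proof (rule limit_in_range[OF A _ below _ x])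
      show "(\<lambda>n. hnorm H (A (poly_op H (g n) T x) \<ominus> x)) \<longlonglongrightarrow> 0"
      proof (rule tendsto_sandwich[of "\<lambda>_. 0" _ _ "\<lambda>n. cmod \<alpha> ^ n * hnorm H x"])
        show "(\<lambda>n. cmod \<alpha> ^ n * hnorm H x) \<longlonglongrightarrow> 0"
          using l1 by (intro tendsto_mult_left_zero LIMSEQ_realpow_zero)
            (auto simp: \<alpha>_def norm_inverse inverse_less_1_iff)
      qed (use x closed bound bounded_opsD(1)[OF A] in \<open>auto intro!: always_eventually\<close>)
    qed (use l1 x closed in auto)
  qed
  then have "op_invertible H A"
    using l1 by (intro op_invertibleI[OF A _ below]) auto
  then show False using l by (simp add: op_spectrum_def A_def)
qed

section \<open>Operator norms and spectral sets\<close>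

lemma op_norm_bound:
  assumes T: "T \<in> bounded_ops H" and x: "x \<in> carrier H"
  shows "hnorm H (T x) \<le> op_norm H T * hnorm H x"
proof (cases "hnorm H x = 0")
  case True
  obtain K where "\<And>v. v \<in> carrier H \<Longrightarrow> hnorm H (T v) \<le> K * hnorm H v"
    using bounded_ops_bound[OF T] by metis
  from this[OF x] show ?thesis using True by simp
next
  case False
  then have pos: "hnorm H x > 0" using x by (simp add: order.strict_iff_order)
  obtain K where K: "K \<ge> 0" "\<And>v. v \<in> carrier H \<Longrightarrow> hnorm H (T v) \<le> K * hnorm H v"
    using bounded_ops_bound[OF T] by metis
  \<comment> \<open>The supremum defining \<open>op_norm\<close> can be estimated from below only
    after the set is known to be bounded.\<close>
  have bdd: "bdd_above ((\<lambda>x. hnorm H (T x)) ` {x \<in> carrier H. hnorm H x \<le> 1})"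
  proof (intro bdd_aboveI2)
    fix v assume "v \<in> {x \<in> carrier H. hnorm H x \<le> 1}"
    then show "hnorm H (T v) \<le> K" using K(2)[of v] mult_left_mono[of "hnorm H v" 1 K] K(1) by simp
  qed
  define c :: complex where "c = of_real (inverse (hnorm H x))"
  have c: "cmod c = inverse (hnorm H x)"
    unfolding c_def norm_of_real using pos by simp
  define u where "u = c \<odot> x"
  have "hnorm H (T u) \<le> op_norm H T"
    unfolding op_norm_def using x pos by (intro cSUP_upper[OF _ bdd]) (simp add: u_def hnorm_scale c)
  moreover have "hnorm H (T u) = inverse (hnorm H x) * hnorm H (T x)"
    using x pos bounded_opsD(1)[OF T] by (simp add: u_def bounded_opsD(3)[OF T] hnorm_scale c)
  ultimately show ?thesis using pos by (simp add: field_simps)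
qed

lemma op_norm_le:
  assumes "M \<ge> 0" "\<And>x. x \<in> carrier H \<Longrightarrow> hnorm H (T x) \<le> M * hnorm H x"
  shows "op_norm H T \<le> M"
  unfolding op_norm_def
proof (rule cSUP_least)
  show "{x \<in> carrier H. hnorm H x \<le> 1} \<noteq> {}" using M.zero_closed hnorm_zero by fastforce
  fix x assume "x \<in> {x \<in> carrier H. hnorm H x \<le> 1}"
  then show "hnorm H (T x) \<le> M" using assms(2)[of x] mult_left_mono[of "hnorm H x" 1 M] assms(1) by simp
qed

theorem spectral_set_contraction:
  assumes T: "T \<in> bounded_ops H"
    and contr: "\<And>x. x \<in> carrier H \<Longrightarrow> hnorm H (T x) \<le> hnorm H x"
  shows "spectral_set (cball 0 1) H T"
  unfolding spectral_set_def
proof (intro conjI, rule spectrum_contraction[OF T contr], assumption, safe)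
  note spec = spectrum_contraction[OF T contr]
  fix p q assume "(p, q) \<in> Rat (cball 0 1)"
  then have q: "q \<noteq> 0" "\<And>z. cmod z \<le> 1 \<Longrightarrow> poly q z \<noteq> 0" by (auto simp: Rat_def)
  define M where "M = (SUP z\<in>cball 0 1. cmod (poly p z / poly q z))"
  have "compact ((\<lambda>z. cmod (poly p z / poly q z)) ` cball 0 1)"
    using q by (intro compact_continuous_image continuous_intros) auto
  then have bdd: "bdd_above ((\<lambda>z. cmod (poly p z / poly q z)) ` cball 0 1)"
    by (intro bounded_imp_bdd_above compact_imp_bounded)
  have M: "cmod (poly p z) \<le> M * cmod (poly q z)" if z: "cmod z \<le> 1" for z
  proof -
    have "cmod (poly p z / poly q z) \<le> M" unfolding M_def using z by (intro cSUP_upper bdd) auto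
    then show ?thesis using q(2)[OF z] by (simp add: norm_divide field_simps)
  qed
  have "0 \<le> cmod (poly p 0 / poly q 0)" by simp
  also have "\<dots> \<le> M" unfolding M_def by (intro cSUP_upper bdd) auto
  finally have "0 \<le> M" .
  have inv: "op_invertible H (poly_op H q T)"
    using q spec by (intro op_invertible_poly_op[OF T]) auto
  note inv_into = op_invertible_inv_into[OF inv poly_op_bounded[OF T]]
  show "op_norm H (rat_op H p q T) \<le> (SUP \<xi>\<in>cball 0 1. cmod (poly p \<xi> / poly q \<xi>))"
    unfolding M_def[symmetric]
  proof (rule op_norm_le[OF \<open>0 \<le> M\<close>])
    fix x assume x: "x \<in> carrier H"
    show "hnorm H (rat_op H p q T x) \<le> M * hnorm H x"
      unfolding rat_op_def
      using von_neumann_inequality[OF T bounded_opsD(1)[OF inv_into(1) x] contr M q(2)] inv_into(2)[OF x]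
      by simp
  qed
qed

text \<open>The form in which a set is refuted: a rational function of modulus at most 1 on
  \<open>X\<close> yields an inequality between two vectors that can be computed explicitly, with no
  need to invert q(T).\<close>

lemma spectral_set_bound:
  assumes X: "spectral_set X H T" and T: "T \<in> bounded_ops H" and y: "y \<in> carrier H"
    and "X \<noteq> {}" and q: "\<And>z. z \<in> X \<Longrightarrow> poly q z \<noteq> 0"
    and le: "\<And>z. z \<in> X \<Longrightarrow> cmod (poly p z) \<le> cmod (poly q z)"
  shows "hnorm H (poly_op H p T y) \<le> hnorm H (poly_op H q T y)"
proof -
  have "q \<noteq> 0" using q \<open>X \<noteq> {}\<close> by auto
  have inv: "op_invertible H (poly_op H q T)"
    using q X \<open>q \<noteq> 0\<close> by (intro op_invertible_poly_op[OF T]) (auto simp: spectral_set_def)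
  note inv_into = op_invertible_inv_into[OF inv poly_op_bounded[OF T]]
  have R: "rat_op H p q T \<in> bounded_ops H"
    unfolding rat_op_def using bounded_ops_compose[OF poly_op_bounded[OF T] inv_into(1)] .
  have "op_norm H (rat_op H p q T) \<le> (SUP z\<in>X. cmod (poly p z / poly q z))"
    using X q \<open>q \<noteq> 0\<close> by (auto simp: spectral_set_def Rat_def)
  also have "\<dots> \<le> 1"
    using \<open>X \<noteq> {}\<close> le q by (intro cSUP_least) (auto simp: norm_divide divide_le_eq)
  finally have norm: "op_norm H (rat_op H p q T) \<le> 1" .
  define x where "x = poly_op H q T y"
  have x: "x \<in> carrier H" using y by (simp add: x_def poly_op_closed[OF T])
  have "hnorm H (rat_op H p q T x) \<le> op_norm H (rat_op H p q T) * hnorm H x"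
    by (rule op_norm_bound[OF R x])
  also have "\<dots> \<le> 1 * hnorm H x" using norm x by (intro mult_right_mono) auto
  finally show ?thesis using inv_into(3)[OF y] by (simp add: rat_op_def x_def)
qed

section \<open>Adjoints\<close>

lemma op_adjoint_eqI:
  assumes "z \<in> carrier H" "\<And>x. x \<in> carrier H \<Longrightarrow> cinner H (T x) y = cinner H x z"
  shows "op_adjoint H T y = z"
  unfolding op_adjoint_def
proof (rule the_equality)
  fix w assume w: "w \<in> carrier H \<and> (\<forall>x\<in>carrier H. cinner H (T x) y = cinner H x w)"
  show "w = z"
  proof (rule cinner_eqI)
    fix v assume "v \<in> carrier H"
    then have "cinner H v w = cinner H v z" using w assms(2) by metis
    then show "cinner H w v = cinner H z v"
      using cinner_commute w assms(1) \<open>v \<in> carrier H\<close> by metis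
  qed (use w assms in auto)
qed (use assms in auto)

lemma op_adjoint_ex:
  assumes T: "T \<in> bounded_ops H" and y: "y \<in> carrier H"
  shows "\<exists>z\<in>carrier H. \<forall>x\<in>carrier H. cinner H (T x) y = cinner H x z"
proof -
  obtain K where K: "\<And>v. v \<in> carrier H \<Longrightarrow> hnorm H (T v) \<le> K * hnorm H v"
    using bounded_ops_bound[OF T] by metis
  note closed = bounded_opsD(1)[OF T]
  show ?thesis
  proof (rule Riesz_representation[of _ "K * hnorm H y"])
    fix x assume x: "x \<in> carrier H"
    have "cmod (cinner H (T x) y) \<le> hnorm H (T x) * hnorm H y"
      using x y closed by (intro Cauchy_Schwarz) auto
    also have "\<dots> \<le> (K * hnorm H x) * hnorm H y" using K[OF x] y by (intro mult_right_mono) auto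
    finally show "cmod (cinner H (T x) y) \<le> K * hnorm H y * hnorm H x" by (simp add: mult_ac)
  qed (use y closed in \<open>simp_all add: bounded_opsD(2,3)[OF T] cinner_linear\<close>)
qed

lemma cinner_op_adjoint:
  assumes T: "T \<in> bounded_ops H" and y: "y \<in> carrier H"
  shows "op_adjoint H T y \<in> carrier H"
    and "x \<in> carrier H \<Longrightarrow> cinner H x (op_adjoint H T y) = cinner H (T x) y"
    and "x \<in> carrier H \<Longrightarrow> cinner H (op_adjoint H T y) x = cinner H y (T x)"
proof -
  obtain z where z: "z \<in> carrier H" "\<And>x. x \<in> carrier H \<Longrightarrow> cinner H (T x) y = cinner H x z"
    using op_adjoint_ex[OF T y] by blast
  then have eq: "op_adjoint H T y = z" by (rule op_adjoint_eqI)
  show "op_adjoint H T y \<in> carrier H" using eq z by simp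
  assume x: "x \<in> carrier H"
  show "cinner H x (op_adjoint H T y) = cinner H (T x) y" using eq z x by simp
  then show "cinner H (op_adjoint H T y) x = cinner H y (T x)"
    using eq z x y bounded_opsD(1)[OF T x] cinner_commute by metis
qed

lemma op_adjoint_bounded:
  assumes T: "T \<in> bounded_ops H"
  shows "op_adjoint H T \<in> bounded_ops H"
proof -
  obtain K where K: "K \<ge> 0" "\<And>v. v \<in> carrier H \<Longrightarrow> hnorm H (T v) \<le> K * hnorm H v"
    using bounded_ops_bound[OF T] by metis
  note adj = cinner_op_adjoint[OF T] and closed = bounded_opsD(1)[OF T]
  show ?thesis
  proof (rule bounded_opsI[of _ K])
    fix x y a assume xy: "x \<in> carrier H" "y \<in> carrier H"
    show "op_adjoint H T x \<in> carrier H" by (rule adj) fact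
    show "op_adjoint H T (x \<oplus> y) = op_adjoint H T x \<oplus> op_adjoint H T y"
      using xy closed by (intro cinner_eqI) (simp_all add: adj cinner_linear)
    show "hnorm H (op_adjoint H T x) \<le> K * hnorm H x"
    proof (cases "hnorm H (op_adjoint H T x) = 0")
      case False
      then have pos: "hnorm H (op_adjoint H T x) > 0" using adj(1)[OF xy(1)] by (simp add: order.strict_iff_order)
      have "(hnorm H (op_adjoint H T x))\<^sup>2 = Re (cinner H (T (op_adjoint H T x)) x)"
        using xy by (simp add: hnorm_square adj)
      also have "\<dots> \<le> cmod (cinner H (T (op_adjoint H T x)) x)" by (rule complex_Re_le_cmod)
      also have "\<dots> \<le> hnorm H (T (op_adjoint H T x)) * hnorm H x"
        using xy closed adj(1) by (intro Cauchy_Schwarz) auto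
      also have "\<dots> \<le> (K * hnorm H (op_adjoint H T x)) * hnorm H x"
        using xy adj(1) K by (intro mult_right_mono) auto
      finally have "hnorm H (op_adjoint H T x) * hnorm H (op_adjoint H T x)
          \<le> hnorm H (op_adjoint H T x) * (K * hnorm H x)"
        by (simp add: power2_eq_square mult_ac)
      then show ?thesis using pos by (simp only: mult_le_cancel_left_pos)
    qed (use K xy in simp)
  next
    fix x a assume x: "x \<in> carrier H"
    show "op_adjoint H T (a \<odot> x) = a \<odot> op_adjoint H T x"
      using x closed by (intro cinner_eqI) (simp_all add: adj cinner_linear)
  qed
qed

lemma op_adjoint_op_adjoint:
  assumes T: "T \<in> bounded_ops H" and x: "x \<in> carrier H"
  shows "op_adjoint H (op_adjoint H T) x = T x"
  using bounded_opsD(1)[OF T x] x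
  by (intro op_adjoint_eqI) (simp_all add: cinner_op_adjoint[OF T])

lemma op_invertible_op_adjoint:
  assumes T: "T \<in> bounded_ops H" and inv: "op_invertible H T"
  shows "op_invertible H (op_adjoint H T)"
proof -
  obtain S where S: "S \<in> bounded_ops H" "\<And>x. x \<in> carrier H \<Longrightarrow> S (T x) = x \<and> T (S x) = x"
    using inv by (auto simp: op_invertible_def)
  note adj = cinner_op_adjoint[OF T] cinner_op_adjoint[OF S(1)]
    and closed = bounded_opsD(1)[OF T] bounded_opsD(1)[OF S(1)]
  have "op_adjoint H S (op_adjoint H T x) = x \<and> op_adjoint H T (op_adjoint H S x) = x"
    if "x \<in> carrier H" for x
    using that closed by (intro conjI; intro cinner_eqI) (simp_all add: adj S(2))
  then show ?thesis
    unfolding op_invertible_def by (intro bexI[OF _ op_adjoint_bounded[OF S(1)]]) blast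
qed

text \<open>Moving T to the other side gives |T x|^2 <= |x| |T x|. For \<open>C_alpha_star\<close>
  the norm estimate is available for the adjoint, and this carries it over to the operator.\<close>

lemma contraction_of_adjoint_contraction:
  assumes T: "T \<in> bounded_ops H" and x: "x \<in> carrier H"
    and contr: "\<And>y. y \<in> carrier H \<Longrightarrow> hnorm H (op_adjoint H T y) \<le> hnorm H y"
  shows "hnorm H (T x) \<le> hnorm H x"
proof (cases "hnorm H (T x) = 0")
  case False
  have Tx: "T x \<in> carrier H" by (rule bounded_opsD(1)[OF T x])
  then have pos: "hnorm H (T x) > 0" using False by (simp add: order.strict_iff_order)
  have "(hnorm H (T x))\<^sup>2 = Re (cinner H x (op_adjoint H T (T x)))"
    using x Tx by (simp add: hnorm_square cinner_op_adjoint[OF T])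
  also have "\<dots> \<le> cmod (cinner H x (op_adjoint H T (T x)))" by (rule complex_Re_le_cmod)
  also have "\<dots> \<le> hnorm H x * hnorm H (op_adjoint H T (T x))"
    using x Tx cinner_op_adjoint(1)[OF T] by (intro Cauchy_Schwarz) auto
  also have "\<dots> \<le> hnorm H x * hnorm H (T x)" using contr[OF Tx] x by (intro mult_left_mono) auto
  finally show ?thesis using pos by (simp add: power2_eq_square)
qed (use x in simp)

text \<open>Pairing with x moves the adjoints to the other argument. Every term is then a squared
  norm, so the value is real and membership in the nonnegative reals is a plain inequality between
  |x|, |T x| and |T (T x)|.\<close>

lemma op_nonneg_C_alpha_iff:
  assumes T: "T \<in> bounded_ops H"
  shows "op_nonneg H (\<lambda>x. \<ominus> op_adjoint H T (op_adjoint H T (T (T x)))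
       \<oplus> complex_of_real (1 + r\<^sup>2) \<odot> op_adjoint H T (T x)
       \<ominus> complex_of_real (r\<^sup>2) \<odot> x)
    \<longleftrightarrow> (\<forall>x\<in>carrier H. (hnorm H (T (T x)))\<^sup>2 + r\<^sup>2 * (hnorm H x)\<^sup>2 \<le> (1 + r\<^sup>2) * (hnorm H (T x))\<^sup>2)"
  unfolding op_nonneg_def
proof (intro ball_cong refl)
  fix x assume x: "x \<in> carrier H"
  note closed = bounded_opsD(1)[OF T] cinner_op_adjoint(1)[OF T]
  have "cinner H (\<ominus> op_adjoint H T (op_adjoint H T (T (T x)))
       \<oplus> complex_of_real (1 + r\<^sup>2) \<odot> op_adjoint H T (T x)
       \<ominus> complex_of_real (r\<^sup>2) \<odot> x) x
    = of_real (- (hnorm H (T (T x)))\<^sup>2 + (1 + r\<^sup>2) * (hnorm H (T x))\<^sup>2 - r\<^sup>2 * (hnorm H x)\<^sup>2)"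
    using x closed by (simp add: cinner_linear cinner_op_adjoint[OF T] cinner_self)
  then show "cinner H (\<ominus> op_adjoint H T (op_adjoint H T (T (T x)))
       \<oplus> complex_of_real (1 + r\<^sup>2) \<odot> op_adjoint H T (T x)
       \<ominus> complex_of_real (r\<^sup>2) \<odot> x) x \<in> \<real>\<^sub>\<ge>\<^sub>0
    \<longleftrightarrow> (hnorm H (T (T x)))\<^sup>2 + r\<^sup>2 * (hnorm H x)\<^sup>2 \<le> (1 + r\<^sup>2) * (hnorm H (T x))\<^sup>2"
    by (simp only: nonneg_Reals_of_real_iff) linarith
qed

end

section \<open>The classes of operators\<close>

lemma C_alpha_iff:
  "(H, T) \<in> C_alpha r \<longleftrightarrow> hilbert_space H \<and> T \<in> bounded_ops H \<and> op_invertible H T \<and>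
     (\<forall>x\<in>carrier H. (hnorm H (T (T x)))\<^sup>2 + r\<^sup>2 * (hnorm H x)\<^sup>2 \<le> (1 + r\<^sup>2) * (hnorm H (T x))\<^sup>2)"
  using hilbert_space.op_nonneg_C_alpha_iff[of H T r] by (auto simp: C_alpha_def)

text \<open>Applied to \<open>b n = \<parallel>T\<^sup>1\<^sup>-\<^sup>n x\<parallel>\<^sup>2\<close>, which is where invertibility of \<open>T\<close> enters.\<close>

lemma decreasing_increments_nonpos:
  fixes b :: "nat \<Rightarrow> real"
  assumes r: "0 < r" "r < 1" and b: "\<And>n. 0 \<le> b n"
    and step: "\<And>n. b n - b (Suc n) \<le> r\<^sup>2 * (b (Suc n) - b (Suc (Suc n)))"
  shows "b 0 \<le> b 1"
proof (rule ccontr)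
  define e where "e = b 0 - b 1"
  assume "\<not> b 0 \<le> b 1"
  then have e: "e > 0" by (simp add: e_def)
  have ge: "e \<le> b n - b (Suc n)" for n
  proof (induction n)
    case 0
    then show ?case by (simp add: e_def)
  next
    case (Suc n)
    then have pos: "0 < r\<^sup>2 * (b (Suc n) - b (Suc (Suc n)))" using e step[of n] by linarith
    then have "0 < b (Suc n) - b (Suc (Suc n))" by (simp add: zero_less_mult_iff)
    then have "r\<^sup>2 * (b (Suc n) - b (Suc (Suc n))) \<le> 1 * (b (Suc n) - b (Suc (Suc n)))"
      using r by (intro mult_right_mono) (auto simp: power_le_one)
    then show ?case using Suc step[of n] by simp
  qed
  have "b n \<le> b 0 - real n * e" for n
  proof (induction n)
    case (Suc n)
    then show ?case using ge[of n] by (simp add: algebra_simps)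
  qed simp
  moreover obtain n where "b 0 < real n * e" using reals_Archimedean3[OF e] by blast
  ultimately show False using b[of n] by (smt (verit))
qed

lemma C_alpha_contraction:
  assumes r: "0 < r" "r < 1" and HT: "(H, T) \<in> C_alpha r" and x: "x \<in> carrier H"
  shows "hnorm H (T x) \<le> hnorm H x"
proof -
  interpret hilbert_space H using HT by (simp add: C_alpha_iff)
  have T: "T \<in> bounded_ops H" "op_invertible H T" using HT by (simp_all add: C_alpha_iff)
  have ineq: "(hnorm H (T (T x)))\<^sup>2 + r\<^sup>2 * (hnorm H x)\<^sup>2 \<le> (1 + r\<^sup>2) * (hnorm H (T x))\<^sup>2"
    if "x \<in> carrier H" for x
    using HT that by (simp add: C_alpha_iff)
  obtain S where S: "S \<in> bounded_ops H" "\<And>x. x \<in> carrier H \<Longrightarrow> S (T x) = x \<and> T (S x) = x"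
    using T(2) by (auto simp: op_invertible_def)
  \<comment> \<open>The backward orbit starts at \<open>T x\<close>, so that the terms with index 0
    and 1 are \<open>T x\<close> and \<open>x\<close>.\<close>
  define v where "v = (\<lambda>n. (S ^^ n) (T x))"
  have v: "v n \<in> carrier H" for n
    unfolding v_def using S(1) bounded_opsD(1)[OF T(1) x]
    by (intro funpow_closed) (auto simp: bounded_ops_def)
  have Tv: "T (v (Suc n)) = v n" for n using S(2)[OF v[of n]] by (simp add: v_def)
  have v01: "v 0 = T x" "v 1 = x" using S(2)[OF x] by (simp_all add: v_def)
  have "(hnorm H (v 0))\<^sup>2 \<le> (hnorm H (v 1))\<^sup>2"
  proof (rule decreasing_increments_nonpos[OF r])
    fix n
    have "(hnorm H (v n))\<^sup>2 + r\<^sup>2 * (hnorm H (v (Suc (Suc n))))\<^sup>2 \<le> (1 + r\<^sup>2) * (hnorm H (v (Suc n)))\<^sup>2"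
      using ineq[OF v[of "Suc (Suc n)"]] by (simp only: Tv)
    then show "(hnorm H (v n))\<^sup>2 - (hnorm H (v (Suc n)))\<^sup>2
        \<le> r\<^sup>2 * ((hnorm H (v (Suc n)))\<^sup>2 - (hnorm H (v (Suc (Suc n))))\<^sup>2)"
      by (simp add: algebra_simps)
  qed simp
  then have "(hnorm H (T x))\<^sup>2 \<le> (hnorm H x)\<^sup>2" by (simp only: v01)
  then show ?thesis by (rule power2_le_imp_le) (simp add: x)
qed

lemma C_alpha_subset_C_1:
  assumes "0 < r" "r < 1"
  shows "C_alpha r \<subseteq> C_1"
proof
  fix HT :: "'a hilbert \<times> ('a \<Rightarrow> 'a)"
  assume "HT \<in> C_alpha r"
  then obtain H T where HT: "HT = (H, T)" "(H, T) \<in> C_alpha r" by (cases HT) auto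
  then interpret hilbert_space H by (simp add: C_alpha_iff)
  have "op_norm H T \<le> 1"
    using C_alpha_contraction[OF assms HT(2)] by (intro op_norm_le) auto
  then show "HT \<in> C_1" using HT by (simp add: C_1_def C_alpha_iff)
qed

lemma C_alpha_star_subset_C_1:
  assumes "0 < r" "r < 1"
  shows "C_alpha_star r \<subseteq> C_1"
proof
  fix HT :: "'a hilbert \<times> ('a \<Rightarrow> 'a)"
  assume "HT \<in> C_alpha_star r"
  then obtain H T where HT: "HT = (H, T)" "hilbert_space H" "T \<in> bounded_ops H"
    and adj: "(H, op_adjoint H T) \<in> C_alpha r" by (cases HT) (auto simp: C_alpha_star_def)
  interpret hilbert_space H by fact
  \<comment> \<open>Invertibility is known for the adjoint only; it returns to \<open>T\<close>
    because the double adjoint agrees with \<open>T\<close> on the carrier.\<close>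
  have "op_invertible H (op_adjoint H (op_adjoint H T))"
    using adj by (intro op_invertible_op_adjoint[of "op_adjoint H T"]) (simp_all add: C_alpha_iff)
  then have "op_invertible H T"
    using op_invertible_cong[OF op_adjoint_op_adjoint[OF HT(3)]] by simp
  moreover have "op_norm H T \<le> 1"
    using contraction_of_adjoint_contraction[OF HT(3)] C_alpha_contraction[OF assms adj]
    by (intro op_norm_le) auto
  ultimately show "HT \<in> C_1" using HT by (simp add: C_1_def)
qed

lemma spectral_set_C_1:
  assumes "(H, T) \<in> C_1"
  shows "spectral_set (cball 0 1) H T"
proof -
  interpret hilbert_space H using assms by (simp add: C_1_def)
  have T: "T \<in> bounded_ops H" "op_norm H T \<le> 1" using assms by (simp_all add: C_1_def)
  show ?thesis
  proof (rule spectral_set_contraction[OF T(1)])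
    fix x assume x: "x \<in> carrier H"
    have "op_norm H T * hnorm H x \<le> 1 * hnorm H x" using T(2) x by (intro mult_right_mono) auto
    then show "hnorm H (T x) \<le> hnorm H x" using op_norm_bound[OF T(1) x] by simp
  qed
qed

text \<open>For a class between \<open>C_alpha_star r\<close> and \<open>C_1\<close>, the spectral
  property is inherited from the larger bound and the operators refuting proper subsets come from
  the smaller one.\<close>

lemma minimal_spectral_set_if_C_alpha_star:
  fixes \<T> :: "('a hilbert \<times> ('a \<Rightarrow> 'a)) set"
  assumes sub: "C_alpha_star r \<subseteq> \<T>" "\<T> \<subseteq> C_1"
    and witness: "\<And>X. compact X \<Longrightarrow> X \<subset> cball 0 1 \<Longrightarrow>
      \<exists>(H, T)\<in>(C_alpha_star r :: ('a hilbert \<times> ('a \<Rightarrow> 'a)) set). \<not> spectral_set X H T"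
  shows "minimal_spectral_set (cball 0 1) \<T>"
  unfolding minimal_spectral_set_def
proof (intro conjI ballI allI impI)
  show "case HT of (H, T) \<Rightarrow> spectral_set (cball 0 1) H T" if "HT \<in> \<T>" for HT
    using that sub(2) spectral_set_C_1 by (cases HT) auto
  show "\<exists>(H, T)\<in>\<T>. \<not> spectral_set X H T" if "compact X \<and> X \<subset> cball 0 1" for X
    using witness[of X] that sub(1) by fast
qed simp

section \<open>Weighted shifts on bilateral sequences\<close>

definition ell2 :: "(int \<Rightarrow> complex) set" where
  "ell2 = {f. (\<lambda>n. (cmod (f n))\<^sup>2) summable_on UNIV}"

definition ell2_inner :: "(int \<Rightarrow> complex) \<Rightarrow> (int \<Rightarrow> complex) \<Rightarrow> complex" where
  "ell2_inner f h = infsum (\<lambda>n. f n * cnj (h n)) UNIV"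

definition ell2_sq :: "(int \<Rightarrow> complex) \<Rightarrow> real" where
  "ell2_sq f = infsum (\<lambda>n. (cmod (f n))\<^sup>2) UNIV"

lemma ell2_zero [simp]: "(\<lambda>_. 0) \<in> ell2"
  by (simp add: ell2_def)

lemma ell2_dominated:
  assumes "f \<in> ell2" "\<And>n. (cmod (h n))\<^sup>2 \<le> C * (cmod (f n))\<^sup>2"
  shows "h \<in> ell2"
  using assms unfolding ell2_def
  by (auto intro: summable_on_comparison_test[OF summable_on_cmult_right[of _ _ C]])

lemma ell2_scale [simp]: "f \<in> ell2 \<Longrightarrow> (\<lambda>n. a * f n) \<in> ell2"
  by (rule ell2_dominated[of f _ "(cmod a)\<^sup>2"]) (simp_all add: norm_mult power_mult_distrib)

lemma ell2_add [simp]: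
  assumes "f \<in> ell2" "h \<in> ell2"
  shows "(\<lambda>n. f n + h n) \<in> ell2"
proof -
  have le: "(cmod (f n + h n))\<^sup>2 \<le> 2 * (cmod (f n))\<^sup>2 + 2 * (cmod (h n))\<^sup>2" for n
  proof -
    have "(cmod (f n + h n))\<^sup>2 \<le> (cmod (f n) + cmod (h n))\<^sup>2"
      by (intro power_mono norm_triangle_ineq) simp
    also have "\<dots> \<le> 2 * (cmod (f n))\<^sup>2 + 2 * (cmod (h n))\<^sup>2"
      using sum_squares_bound[of "cmod (f n)" "cmod (h n)"] by (simp add: power2_sum)
    finally show ?thesis .
  qed
  have "(\<lambda>n. 2 * (cmod (f n))\<^sup>2 + 2 * (cmod (h n))\<^sup>2) summable_on UNIV"
    using assms by (intro summable_on_add summable_on_cmult_right) (simp_all add: ell2_def)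
  then show ?thesis
    unfolding ell2_def by (auto intro: summable_on_comparison_test le)
qed

lemma ell2_diff [simp]: "f \<in> ell2 \<Longrightarrow> h \<in> ell2 \<Longrightarrow> (\<lambda>n. f n - h n) \<in> ell2"
  using ell2_add[of f "\<lambda>n. (-1) * h n"] ell2_scale[of h "-1"] by simp

lemma ell2_inner_summable:
  assumes "f \<in> ell2" "h \<in> ell2"
  shows "(\<lambda>n. f n * cnj (h n)) summable_on UNIV"
proof (rule abs_summable_summable, rule summable_on_comparison_test)
  show "(\<lambda>n. (cmod (f n))\<^sup>2 + (cmod (h n))\<^sup>2) summable_on UNIV"
    using assms by (intro summable_on_add) (simp_all add: ell2_def)
  fix n
  show "norm (f n * cnj (h n)) \<le> (cmod (f n))\<^sup>2 + (cmod (h n))\<^sup>2"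
    using sum_squares_bound[of "cmod (f n)" "cmod (h n)"] mult_nonneg_nonneg[of "cmod (f n)" "cmod (h n)"]
    unfolding norm_mult complex_mod_cnj mult.assoc by (smt (verit) norm_ge_zero)
qed simp

lemma ell2_inner_add:
  "f \<in> ell2 \<Longrightarrow> f' \<in> ell2 \<Longrightarrow> h \<in> ell2 \<Longrightarrow>
   ell2_inner (\<lambda>n. f n + f' n) h = ell2_inner f h + ell2_inner f' h"
  unfolding ell2_inner_def by (simp add: distrib_right infsum_add ell2_inner_summable)

lemma ell2_inner_scale: "ell2_inner (\<lambda>n. a * f n) h = a * ell2_inner f h"
  unfolding ell2_inner_def by (simp add: mult.assoc infsum_cmult_right')

lemma ell2_inner_commute: "ell2_inner h f = cnj (ell2_inner f h)"
  unfolding ell2_inner_def by (simp add: mult.commute flip: infsum_cnj)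

lemma ell2_inner_self: "f \<in> ell2 \<Longrightarrow> ell2_inner f f = of_real (ell2_sq f)"
  unfolding ell2_inner_def ell2_sq_def ell2_def complex_norm_square[symmetric]
  by (rule infsumI[OF has_sum_of_real]) simp

lemma ell2_sq_nonneg [simp]: "0 \<le> ell2_sq f"
  unfolding ell2_sq_def by (intro infsum_nonneg) simp

lemma ell2_component_le:
  assumes "f \<in> ell2"
  shows "(cmod (f n))\<^sup>2 \<le> ell2_sq f"
  using finite_sum_le_infsum[of "\<lambda>n. (cmod (f n))\<^sup>2" UNIV "{n}"] assms
  by (simp add: ell2_sq_def ell2_def)

lemma ell2_sq_eq_0:
  assumes "f \<in> ell2" "ell2_sq f = 0"
  shows "f = (\<lambda>_. 0)"
proof
  fix n show "f n = 0" using ell2_component_le[OF assms(1), of n] assms(2) by simp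
qed

text \<open>The limit is taken componentwise. The Cauchy estimate on a finite set of indices
  survives the limit, and bounds on all finite sums bound the whole series.\<close>

lemma ell2_complete:
  assumes F: "\<And>n. F n \<in> ell2"
    and Cauchy: "\<And>e. e > 0 \<Longrightarrow> \<exists>N. \<forall>m\<ge>N. \<forall>n\<ge>N. ell2_sq (\<lambda>k. F m k - F n k) < e"
  shows "\<exists>G\<in>ell2. (\<lambda>n::nat. ell2_sq (\<lambda>k. F n k - G k)) \<longlonglongrightarrow> 0"
proof -
  have "Cauchy (\<lambda>n. F n k)" for k
  proof (rule metric_CauchyI)
    fix e :: real assume e: "e > 0"
    then obtain N where N: "\<And>m n. m \<ge> N \<Longrightarrow> n \<ge> N \<Longrightarrow> ell2_sq (\<lambda>k. F m k - F n k) < e\<^sup>2"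
      using Cauchy[of "e\<^sup>2"] by auto
    have "dist (F m k) (F n k) < e" if "m \<ge> N" "n \<ge> N" for m n
    proof (rule power_less_imp_less_base)
      show "(dist (F m k) (F n k))\<^sup>2 < e\<^sup>2"
        using ell2_component_le[of "\<lambda>k. F m k - F n k" k] F N[OF that] by (simp add: dist_norm)
    qed (use e in simp)
    then show "\<exists>M. \<forall>m\<ge>M. \<forall>n\<ge>M. dist (F m k) (F n k) < e" by blast
  qed
  then have "\<exists>l. (\<lambda>n. F n k) \<longlonglongrightarrow> l" for k
    by (simp add: Cauchy_convergent_iff convergent_def)
  then obtain G where G: "\<And>k. (\<lambda>n. F n k) \<longlonglongrightarrow> G k" by metis
  have close: "\<exists>N. \<forall>m\<ge>N. (\<lambda>k. F m k - G k) \<in> ell2 \<and> ell2_sq (\<lambda>k. F m k - G k) \<le> e" if e: "e > 0" for e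
  proof -
    obtain N where N: "\<And>m n. m \<ge> N \<Longrightarrow> n \<ge> N \<Longrightarrow> ell2_sq (\<lambda>k. F m k - F n k) < e"
      using Cauchy[OF e] by auto
    have "(\<lambda>k. F m k - G k) \<in> ell2 \<and> ell2_sq (\<lambda>k. F m k - G k) \<le> e" if m: "m \<ge> N" for m
    proof -
      have fin: "(\<Sum>k\<in>A. (cmod (F m k - G k))\<^sup>2) \<le> e" if A: "finite A" for A
      proof (rule LIMSEQ_le_const2)
        show "(\<lambda>n. \<Sum>k\<in>A. (cmod (F m k - F n k))\<^sup>2) \<longlonglongrightarrow> (\<Sum>k\<in>A. (cmod (F m k - G k))\<^sup>2)"
          by (intro tendsto_intros G)
        have "(\<Sum>k\<in>A. (cmod (F m k - F n k))\<^sup>2) \<le> e" if n: "n \<ge> N" for n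
        proof -
          have "(\<Sum>k\<in>A. (cmod (F m k - F n k))\<^sup>2) \<le> ell2_sq (\<lambda>k. F m k - F n k)"
            unfolding ell2_sq_def using ell2_diff[OF F F, of m n] A
            by (intro finite_sum_le_infsum) (auto simp: ell2_def)
          also have "\<dots> \<le> e" using N[OF m n] by simp
          finally show ?thesis .
        qed
        then show "\<exists>N. \<forall>n\<ge>N. (\<Sum>k\<in>A. (cmod (F m k - F n k))\<^sup>2) \<le> e" by blast
      qed
      have "(\<lambda>k. F m k - G k) \<in> ell2"
        unfolding ell2_def mem_Collect_eq
        by (rule nonneg_bdd_above_summable_on) (auto intro!: bdd_aboveI2 fin)
      moreover from this have "ell2_sq (\<lambda>k. F m k - G k) \<le> e"
        unfolding ell2_sq_def ell2_def by (intro infsum_le_finite_sums fin) auto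
      ultimately show ?thesis by blast
    qed
    then show ?thesis by blast
  qed
  obtain m where m: "(\<lambda>k. F m k - G k) \<in> ell2" using close[of 1] by auto
  have "G \<in> ell2" using ell2_diff[OF F[of m] m] by simp
  moreover have "(\<lambda>n. ell2_sq (\<lambda>k. F n k - G k)) \<longlonglongrightarrow> 0"
  proof (rule LIMSEQ_I)
    fix e :: real assume "e > 0"
    then show "\<exists>N. \<forall>n\<ge>N. norm (ell2_sq (\<lambda>k. F n k - G k) - 0) < e"
      using close[of "e / 2"] by fastforce
  qed
  ultimately show ?thesis by blast
qed

text \<open>Sends the basis vector e_m to w(m - k) times e_(m-k): weights are indexed by the target,
  k = -1 is the forward shift and k = 0 a diagonal operator. With arbitrary k the family is closed
  under composition and adjoints.\<close>

definition wshift :: "(int \<Rightarrow> complex) \<Rightarrow> int \<Rightarrow> (int \<Rightarrow> complex) \<Rightarrow> int \<Rightarrow> complex" where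
  "wshift w k f = (\<lambda>n. w n * f (n + k))"

lemma ell2_translate:
  fixes k :: int
  assumes "f \<in> ell2"
  shows "(\<lambda>n. f (n + k)) \<in> ell2"
  using assms summable_on_reindex_bij_betw[of "\<lambda>n. n + k" UNIV UNIV "\<lambda>n. (cmod (f n))\<^sup>2"]
  by (simp add: ell2_def bij_plus_right)

lemma wshift_ell2:
  assumes "f \<in> ell2" "\<And>n. cmod (w n) \<le> B"
  shows "wshift w k f \<in> ell2" and "ell2_sq (wshift w k f) \<le> B\<^sup>2 * ell2_sq f"
proof -
  note tr = ell2_translate[OF assms(1), of k]
  have le: "(cmod (w n * f (n + k)))\<^sup>2 \<le> B\<^sup>2 * (cmod (f (n + k)))\<^sup>2" for n
    using assms(2)[of n] by (simp add: norm_mult power_mult_distrib mult_right_mono power_mono)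
  show "wshift w k f \<in> ell2" unfolding wshift_def by (rule ell2_dominated[OF tr le])
  then have "ell2_sq (wshift w k f) \<le> infsum (\<lambda>n. B\<^sup>2 * (cmod (f (n + k)))\<^sup>2) UNIV"
    unfolding ell2_sq_def wshift_def using tr le
    by (intro infsum_mono summable_on_cmult_right) (simp_all add: ell2_def)
  also have "\<dots> = B\<^sup>2 * ell2_sq (\<lambda>n. f (n + k))" by (simp add: ell2_sq_def infsum_cmult_right')
  also have "ell2_sq (\<lambda>n. f (n + k)) = ell2_sq f"
    unfolding ell2_sq_def
    by (rule infsum_reindex_bij_betw[of "\<lambda>n. n + k" UNIV UNIV "\<lambda>n. (cmod (f n))\<^sup>2"]) (simp add: bij_plus_right)
  finally show "ell2_sq (wshift w k f) \<le> B\<^sup>2 * ell2_sq f" .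
qed

lemma wshift_adjoint:
  "ell2_inner (wshift w k f) h = ell2_inner f (wshift (\<lambda>n. cnj (w (n - k))) (- k) h)"
proof -
  have "ell2_inner (wshift w k f) h = infsum (\<lambda>n. (\<lambda>m. f m * cnj (cnj (w (m - k)) * h (m + - k))) (n + k)) UNIV"
    unfolding ell2_inner_def wshift_def by (intro infsum_cong) (simp add: mult_ac)
  also have "\<dots> = ell2_inner f (wshift (\<lambda>n. cnj (w (n - k))) (- k) h)"
    unfolding ell2_inner_def wshift_def
    by (rule infsum_reindex_bij_betw) (simp add: bij_plus_right)
  finally show ?thesis .
qed

lemma wshift_wshift: "wshift w k (wshift v j f) = wshift (\<lambda>n. w n * v (n + k)) (k + j) f"
  by (simp add: wshift_def algebra_simps)

lemma ell2_sq_wshift: "ell2_sq (wshift w k f) = infsum (\<lambda>n. (cmod (w (n - k)))\<^sup>2 * (cmod (f n))\<^sup>2) UNIV"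
proof -
  have "ell2_sq (wshift w k f) = infsum (\<lambda>n. (\<lambda>m. (cmod (w (m - k)))\<^sup>2 * (cmod (f m))\<^sup>2) (n + k)) UNIV"
    unfolding ell2_sq_def wshift_def by (intro infsum_cong) (simp add: norm_mult power_mult_distrib)
  also have "\<dots> = infsum (\<lambda>n. (cmod (w (n - k)))\<^sup>2 * (cmod (f n))\<^sup>2) UNIV"
    by (rule infsum_reindex_bij_betw) (simp add: bij_plus_right)
  finally show ?thesis .
qed

section \<open>The sequence space on an arbitrary type of vectors\<close>

text \<open>
  The type of vectors is arbitrary, so the space \<open>\<ell>\<^sup>2(\<int>)\<close> is carried over to it by an injection of
  the bilateral sequences.
\<close>

definition ell2_space :: "((int \<Rightarrow> complex) \<Rightarrow> 'a) \<Rightarrow> 'a hilbert" where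
  "ell2_space g = \<lparr>carrier = g ` ell2, monoid.mult = (\<lambda>x y. x), monoid.one = g (\<lambda>_. 0),
     ring.zero = g (\<lambda>_. 0), ring.add = (\<lambda>x y. g (\<lambda>n. inv_into UNIV g x n + inv_into UNIV g y n)),
     module.smult = (\<lambda>a x. g (\<lambda>n. a * inv_into UNIV g x n)),
     cinner = (\<lambda>x y. ell2_inner (inv_into UNIV g x) (inv_into UNIV g y))\<rparr>"

definition transport :: "((int \<Rightarrow> complex) \<Rightarrow> 'a) \<Rightarrow> ((int \<Rightarrow> complex) \<Rightarrow> int \<Rightarrow> complex) \<Rightarrow> 'a \<Rightarrow> 'a" where
  "transport g A x = g (A (inv_into UNIV g x))"

locale ell2_embedding =
  fixes g :: "(int \<Rightarrow> complex) \<Rightarrow> 'a"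
  assumes inj: "inj g"
begin

abbreviation "L \<equiv> ell2_space g"

lemma ell2_space_simps [simp]:
  "carrier L = g ` ell2"
  "\<zero>\<^bsub>L\<^esub> = g (\<lambda>_. 0)"
  "g f \<oplus>\<^bsub>L\<^esub> g h = g (\<lambda>n. f n + h n)"
  "a \<odot>\<^bsub>L\<^esub> g f = g (\<lambda>n. a * f n)"
  "cinner L (g f) (g h) = ell2_inner f h"
  "transport g A (g f) = g (A f)"
  by (simp_all add: ell2_space_def transport_def inv_f_f[OF inj])

lemma hnorm_ell2: "f \<in> ell2 \<Longrightarrow> hnorm L (g f) = sqrt (ell2_sq f)"
  by (simp add: hnorm_def ell2_inner_self)

lemma cring_complex_ring: "cring complex_ring"
proof (rule cringI)
  show "abelian_group complex_ring"
  proof (rule abelian_groupI)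
    fix x :: complex
    show "\<exists>y\<in>carrier complex_ring. y \<oplus>\<^bsub>complex_ring\<^esub> x = \<zero>\<^bsub>complex_ring\<^esub>"
      by (rule bexI[of _ "- x"]) simp_all
  qed simp_all
  show "comm_monoid complex_ring"
    by (rule comm_monoidI) simp_all
qed (simp_all add: distrib_right)

lemma module_ell2: "Module.module complex_ring L"
proof (rule moduleI[OF cring_complex_ring])
  show "abelian_group L"
  proof (rule abelian_groupI)
    fix x assume "x \<in> carrier L"
    then obtain f where "f \<in> ell2" "x = g f" by auto
    then show "\<exists>y\<in>carrier L. y \<oplus>\<^bsub>L\<^esub> x = \<zero>\<^bsub>L\<^esub>"
      using ell2_scale[of f "-1"] by (intro bexI[of _ "g (\<lambda>n. (-1) * f n)"]) auto
  qed (auto simp: algebra_simps)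
qed (auto simp: algebra_simps)

text \<open>Subtraction is not a field of the record but comes from the group inverse, so it has to
  be identified through uniqueness of inverses.\<close>

lemma minus_ell2: "f \<in> ell2 \<Longrightarrow> h \<in> ell2 \<Longrightarrow> g f \<ominus>\<^bsub>L\<^esub> g h = g (\<lambda>n. f n - h n)"
proof -
  assume fh: "f \<in> ell2" "h \<in> ell2"
  interpret Module.module complex_ring L by (rule module_ell2)
  have mem: "g (\<lambda>n. (-1) * h n) \<in> carrier L" using ell2_scale[OF fh(2), of "-1"] by (simp only: ell2_space_simps imageI)
  have "\<ominus>\<^bsub>L\<^esub> g h = g (\<lambda>n. (-1) * h n)"
    by (rule M.minus_equality[OF _ _ mem]) (use fh in simp_all)
  then show ?thesis by (simp add: a_minus_def)
qed

lemma hilbert_space_ell2: "hilbert_space L"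
proof (intro hilbert_space.intro module_ell2 hilbert_space_axioms.intro)
  fix x y z a assume "x \<in> carrier L" "y \<in> carrier L" "z \<in> carrier L"
  then show "cinner L (x \<oplus>\<^bsub>L\<^esub> y) z = cinner L x z + cinner L y z"
    by (auto simp: ell2_inner_add)
next
  fix x y assume "x \<in> carrier L" "y \<in> carrier L"
  then show "cinner L y x = cnj (cinner L x y)"
    by (auto simp: ell2_inner_commute[symmetric])
next
  fix x z a assume "x \<in> carrier L" "z \<in> carrier L"
  then show "cinner L (a \<odot>\<^bsub>L\<^esub> x) z = a * cinner L x z"
    by (auto simp: ell2_inner_scale)
next
  fix x assume x: "x \<in> carrier L"
  then show "cinner L x x \<in> \<real>\<^sub>\<ge>\<^sub>0" by (auto simp: ell2_inner_self)
  show "x = \<zero>\<^bsub>L\<^esub>" if "cinner L x x = 0" using x that ell2_sq_eq_0 by (auto simp: ell2_inner_self)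
next
  fix s :: "nat \<Rightarrow> 'a"
  assume s: "\<And>n. s n \<in> carrier L"
    and Cauchy: "\<And>e. e > 0 \<Longrightarrow> \<exists>N. \<forall>m\<ge>N. \<forall>n\<ge>N. hnorm L (s m \<ominus>\<^bsub>L\<^esub> s n) < e"
  have "\<forall>n. \<exists>f. f \<in> ell2 \<and> s n = g f" using s by auto
  then obtain F where F: "\<And>n. F n \<in> ell2" "\<And>n. s n = g (F n)" by metis
  have "\<exists>G\<in>ell2. (\<lambda>n. ell2_sq (\<lambda>k. F n k - G k)) \<longlonglongrightarrow> 0"
  proof (rule ell2_complete[OF F(1)])
    fix e :: real assume "e > 0"
    then obtain N where N: "\<forall>m\<ge>N. \<forall>n\<ge>N. hnorm L (s m \<ominus>\<^bsub>L\<^esub> s n) < sqrt e" using Cauchy[of "sqrt e"] by auto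
    then show "\<exists>N. \<forall>m\<ge>N. \<forall>n\<ge>N. ell2_sq (\<lambda>k. F m k - F n k) < e"
      by (simp add: F minus_ell2 hnorm_ell2) blast
  qed
  then obtain G where G: "G \<in> ell2" "(\<lambda>n. ell2_sq (\<lambda>k. F n k - G k)) \<longlonglongrightarrow> 0" by blast
  have "(\<lambda>n. hnorm L (s n \<ominus>\<^bsub>L\<^esub> g G)) \<longlonglongrightarrow> 0"
    using tendsto_real_sqrt[OF G(2)] by (simp add: F minus_ell2 hnorm_ell2 G)
  then show "\<exists>x\<in>carrier L. (\<lambda>n. hnorm L (s n \<ominus>\<^bsub>L\<^esub> x)) \<longlonglongrightarrow> 0" using G(1) by auto
qed

sublocale hilbert_space L by (rule hilbert_space_ell2)

lemma transport_wshift_bounded: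
  assumes "\<And>n. cmod (w n) \<le> B"
  shows "transport g (wshift w k) \<in> bounded_ops L"
proof (rule bounded_opsI[of _ B])
  have "B \<ge> 0" using assms[of 0] by (meson norm_ge_zero order_trans)
  fix x y a assume "x \<in> carrier L" "y \<in> carrier L"
  then obtain f h where fh: "f \<in> ell2" "x = g f" "h \<in> ell2" "y = g h" by auto
  show "transport g (wshift w k) x \<in> carrier L" using fh wshift_ell2(1)[OF _ assms] by simp
  show "transport g (wshift w k) (x \<oplus>\<^bsub>L\<^esub> y) = transport g (wshift w k) x \<oplus>\<^bsub>L\<^esub> transport g (wshift w k) y"
    using fh by (simp add: wshift_def distrib_left)
  show "hnorm L (transport g (wshift w k) x) \<le> B * hnorm L x"
    using real_sqrt_le_mono[OF wshift_ell2(2)[OF fh(1) assms, where k = k]] wshift_ell2(1)[OF _ assms] fh \<open>B \<ge> 0\<close>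
    by (simp add: hnorm_ell2 real_sqrt_mult)
next
  fix x a assume "x \<in> carrier L"
  then show "transport g (wshift w k) (a \<odot>\<^bsub>L\<^esub> x) = a \<odot>\<^bsub>L\<^esub> transport g (wshift w k) x"
    by (auto simp: wshift_def mult_ac)
qed

lemma transport_wshift_invertible:
  assumes c: "c > 0" "\<And>n. c \<le> cmod (w n)"
  shows "op_invertible L (transport g (wshift w k))"
  unfolding op_invertible_def
proof (rule bexI)
  have nz: "w n \<noteq> 0" for n using c(2)[of n] c(1) by auto
  show "transport g (wshift (\<lambda>n. inverse (w (n - k))) (- k)) \<in> bounded_ops L"
  proof (rule transport_wshift_bounded)
    fix n show "cmod (inverse (w (n - k))) \<le> inverse c"
      using c nz by (simp add: norm_inverse le_imp_inverse_le)
  qed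
  show "\<forall>x\<in>carrier L.
      transport g (wshift (\<lambda>n. inverse (w (n - k))) (- k)) (transport g (wshift w k) x) = x \<and>
      transport g (wshift w k) (transport g (wshift (\<lambda>n. inverse (w (n - k))) (- k)) x) = x"
    using nz by (auto simp: wshift_wshift) (auto simp: wshift_def)
qed

lemma op_adjoint_transport_wshift:
  assumes "\<And>n. cmod (w n) \<le> B" "f \<in> ell2"
  shows "op_adjoint L (transport g (wshift w k)) (g f) = g (wshift (\<lambda>n. cnj (w (n - k))) (- k) f)"
proof (rule op_adjoint_eqI)
  show "g (wshift (\<lambda>n. cnj (w (n - k))) (- k) f) \<in> carrier L"
    using assms by (auto intro!: wshift_ell2(1)[of _ _ B])
qed (auto simp: wshift_adjoint)

text \<open>Reindexed by \<open>ell2_sq_wshift\<close>, the squared norms of f and of its first two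
  images under the adjoint are sums of |f n|^2 with different weights. The class condition therefore
  follows from an inequality between neighbouring weights for each index.\<close>

lemma transport_wshift_C_alpha_star:
  assumes B: "\<And>n. cmod (w n) \<le> B" and c: "c > 0" "\<And>n. c \<le> cmod (w n)"
    and ineq: "\<And>n. (cmod (w (n + k)))\<^sup>2 * (cmod (w n))\<^sup>2 + r\<^sup>2 \<le> (1 + r\<^sup>2) * (cmod (w n))\<^sup>2"
  shows "(L, transport g (wshift w k)) \<in> C_alpha_star r"
proof -
  let ?T = "transport g (wshift w k)"
  define v where "v = (\<lambda>n. cnj (w (n - k)))"
  have v: "cmod (v n) \<le> B" for n using B by (simp add: v_def)
  have T: "?T \<in> bounded_ops L" by (rule transport_wshift_bounded[OF B])
  have adj: "op_adjoint L ?T (g f) = g (wshift v (- k) f)" if "f \<in> ell2" for f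
    unfolding v_def by (rule op_adjoint_transport_wshift[OF B that])
  have "(hnorm L (op_adjoint L ?T (op_adjoint L ?T x)))\<^sup>2 + r\<^sup>2 * (hnorm L x)\<^sup>2
      \<le> (1 + r\<^sup>2) * (hnorm L (op_adjoint L ?T x))\<^sup>2" if "x \<in> carrier L" for x
  proof -
    obtain f where f: "f \<in> ell2" "x = g f" using \<open>x \<in> carrier L\<close> by auto
    have v2: "cmod (v n * v (n + - k)) \<le> B * B" for n
      unfolding norm_mult by (intro mult_mono v order_trans[OF norm_ge_zero v] norm_ge_zero)
    note mem = wshift_ell2(1)[OF f(1) v] wshift_ell2(1)[OF f(1) v2]
    have sq: "ell2_sq (wshift v (- k) f) = infsum (\<lambda>n. (cmod (w n))\<^sup>2 * (cmod (f n))\<^sup>2) UNIV"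
      "ell2_sq (wshift v (- k) (wshift v (- k) f))
        = infsum (\<lambda>n. ((cmod (w (n + k)))\<^sup>2 * (cmod (w n))\<^sup>2) * (cmod (f n))\<^sup>2) UNIV"
      unfolding wshift_wshift ell2_sq_wshift
      by (auto simp: v_def norm_mult power_mult_distrib algebra_simps)
    have summable: "(\<lambda>n. (cmod (w n))\<^sup>2 * (cmod (f n))\<^sup>2) summable_on UNIV"
      "(\<lambda>n. ((cmod (w (n + k)))\<^sup>2 * (cmod (w n))\<^sup>2) * (cmod (f n))\<^sup>2) summable_on UNIV"
      "(\<lambda>n. (cmod (f n))\<^sup>2) summable_on UNIV"
    proof -
      show f_sum: "(\<lambda>n. (cmod (f n))\<^sup>2) summable_on UNIV" using f(1) by (simp add: ell2_def)
      have wB: "(cmod (w n))\<^sup>2 \<le> B\<^sup>2" for n using B[of n] by (simp add: power_mono)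
      have wB2: "(cmod (w (n + k)))\<^sup>2 * (cmod (w n))\<^sup>2 \<le> B\<^sup>2 * B\<^sup>2" for n
        by (intro mult_mono wB) simp_all
      show "(\<lambda>n. (cmod (w n))\<^sup>2 * (cmod (f n))\<^sup>2) summable_on UNIV"
        by (rule summable_on_comparison_test[OF summable_on_cmult_right[OF f_sum, of "B\<^sup>2"]])
           (auto intro: mult_right_mono wB)
      show "(\<lambda>n. ((cmod (w (n + k)))\<^sup>2 * (cmod (w n))\<^sup>2) * (cmod (f n))\<^sup>2) summable_on UNIV"
      proof (rule summable_on_comparison_test[OF summable_on_cmult_right[OF f_sum, of "B\<^sup>2 * B\<^sup>2"]])
        fix n
        show "((cmod (w (n + k)))\<^sup>2 * (cmod (w n))\<^sup>2) * (cmod (f n))\<^sup>2 \<le> (B\<^sup>2 * B\<^sup>2) * (cmod (f n))\<^sup>2"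
          by (rule mult_right_mono[OF wB2]) simp
      qed simp
    qed
    have "ell2_sq (wshift v (- k) (wshift v (- k) f)) + r\<^sup>2 * ell2_sq f
        = infsum (\<lambda>n. ((cmod (w (n + k)))\<^sup>2 * (cmod (w n))\<^sup>2) * (cmod (f n))\<^sup>2 + r\<^sup>2 * (cmod (f n))\<^sup>2) UNIV"
      unfolding sq using summable
      by (subst infsum_add) (simp_all add: summable_on_cmult_right infsum_cmult_right' ell2_sq_def)
    also have "\<dots> \<le> infsum (\<lambda>n. (1 + r\<^sup>2) * ((cmod (w n))\<^sup>2 * (cmod (f n))\<^sup>2)) UNIV"
    proof (rule infsum_mono)
      fix n
      show "((cmod (w (n + k)))\<^sup>2 * (cmod (w n))\<^sup>2) * (cmod (f n))\<^sup>2 + r\<^sup>2 * (cmod (f n))\<^sup>2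
          \<le> (1 + r\<^sup>2) * ((cmod (w n))\<^sup>2 * (cmod (f n))\<^sup>2)"
        using mult_right_mono[OF ineq[of n], of "(cmod (f n))\<^sup>2"] by (simp add: algebra_simps)
    qed (use summable in \<open>auto intro!: summable_on_add summable_on_cmult_right\<close>)
    also have "\<dots> = (1 + r\<^sup>2) * ell2_sq (wshift v (- k) f)"
      unfolding sq by (simp add: infsum_cmult_right')
    finally show ?thesis
      using f mem by (simp add: adj wshift_wshift hnorm_ell2)
  qed
  then have "(L, op_adjoint L ?T) \<in> C_alpha r"
    unfolding C_alpha_iff
    using hilbert_space_ell2 op_adjoint_bounded[OF T]
      op_invertible_op_adjoint[OF T transport_wshift_invertible[OF c]] by blast
  then show ?thesis using hilbert_space_ell2 T by (simp add: C_alpha_star_def)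
qed

end

section \<open>Operators detecting the holes of a compact set\<close>

text \<open>The rational cuts below the real and imaginary parts of all terms code a sequence as a
  subset of a countable set. Thus a universe as large as the complex numbers has room for the whole
  sequence space.\<close>

lemma sequences_lepoll_complex: "(UNIV :: (int \<Rightarrow> complex) set) \<lesssim> (UNIV :: complex set)"
proof -
  define \<Phi> :: "(int \<Rightarrow> complex) \<Rightarrow> (int \<times> rat \<times> bool) set" where
    "\<Phi> = (\<lambda>f. {(n, q, b). of_rat q < (if b then Re (f n) else Im (f n))})"
  have "inj \<Phi>"
  proof (rule injI)
    fix f h assume eq: "\<Phi> f = \<Phi> h"
    have lt: "real_of_rat q < (if b then Re (f n) else Im (f n))
        \<longleftrightarrow> real_of_rat q < (if b then Re (h n) else Im (h n))" for n q b
      using eq by (auto simp: \<Phi>_def set_eq_iff)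
    have rat_eq: "x = y" if "\<And>q. real_of_rat q < x \<longleftrightarrow> real_of_rat q < y" for x y :: real
    proof (rule ccontr)
      assume "x \<noteq> y"
      then have "min x y < max x y" by (auto simp: min_def max_def)
      then obtain q where "min x y < real_of_rat q" "real_of_rat q < max x y"
        using of_rat_dense[of "min x y" "max x y"] by auto
      then show False using that[of q] by (auto simp: min_def max_def split: if_splits)
    qed
    show "f = h"
    proof
      fix n show "f n = h n"
        using rat_eq[of "Re (f n)" "Re (h n)"] rat_eq[of "Im (f n)" "Im (h n)"] lt[of _ True n] lt[of _ False n]
        by (simp add: complex_eq_iff)
    qed
  qed
  then have "inj (\<lambda>f. to_nat ` \<Phi> f)"
    by (auto simp: inj_def inj_image_eq_iff)
  then have "(UNIV :: (int \<Rightarrow> complex) set) \<lesssim> (UNIV :: nat set set)"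
    by (auto simp: lepoll_def)
  also have "(UNIV :: nat set set) \<lesssim> (UNIV :: real set)"
    using nat_sets_eqpoll_reals by (rule eqpoll_imp_lepoll)
  also have "(UNIV :: real set) \<lesssim> (UNIV :: complex set)"
    by (auto simp: lepoll_def inj_on_def intro!: exI[of _ complex_of_real])
  finally show ?thesis .
qed

text \<open>The formula for 1 - |b_c(z)|^2, cleared of its denominator.\<close>

lemma cmod_sq_one_minus_cnj_mult:
  "(cmod (1 - cnj c * z))\<^sup>2 = (cmod (z - c))\<^sup>2 + (1 - (cmod c)\<^sup>2) * (1 - (cmod z)\<^sup>2)"
  by (simp add: cmod_power2) (simp add: power2_eq_square algebra_simps)

text \<open>
  On the unit disk the Blaschke factor \<open>b\<^sub>c\<close> satisfies \<open>|b\<^sub>c|\<^sup>2 \<le> |b\<^sub>\<mu>|\<close> away from \<open>\<mu>\<close>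
  as soon as \<open>c\<close> is close to \<open>\<mu>\<close>, because \<open>|b\<^sub>c|\<^sup>4\<close> vanishes to twice the order of \<open>|b\<^sub>\<mu>|\<^sup>2\<close> at
  the unit circle.
\<close>

lemma blaschke_square_le:
  assumes z: "cmod z \<le> 1" and far: "4 * cmod (\<mu> - c) \<le> cmod (z - \<mu>)"
    and c: "cmod c \<le> cmod \<mu>" "cmod \<mu> < 1"
  shows "(cmod (z - c))\<^sup>2 * cmod (1 - cnj \<mu> * z) \<le> (cmod (1 - cnj c * z))\<^sup>2 * cmod (z - \<mu>)"
proof (rule power2_le_imp_le)
  define A B where "A = (cmod (z - c))\<^sup>2" and "B = (cmod (z - \<mu>))\<^sup>2"
  define a b w where "a = 1 - (cmod c)\<^sup>2" and "b = 1 - (cmod \<mu>)\<^sup>2" and "w = 1 - (cmod z)\<^sup>2"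
  have w: "0 \<le> w" using z by (simp add: w_def power_le_one)
  have b: "0 \<le> b" using c by (simp add: b_def power_le_one)
  have ab: "b \<le> a" using c by (simp add: a_def b_def power_mono)
  have "cmod (z - c) \<le> cmod (z - \<mu>) + cmod (\<mu> - c)" using norm_triangle_ineq[of "z - \<mu>" "\<mu> - c"] by simp
  also have "\<dots> \<le> 5 / 4 * cmod (z - \<mu>)" using far by simp
  finally have "A \<le> (5 / 4 * cmod (z - \<mu>))\<^sup>2" unfolding A_def by (rule power_mono) simp
  then have "A \<le> 25 / 16 * B" by (simp add: B_def power_mult_distrib power_divide)
  moreover have nonneg: "0 \<le> A" "0 \<le> B" by (simp_all add: A_def B_def)
  \<comment> \<open>The factor 4 in \<open>far\<close> makes (5/4)^2 < 2, and 2 is the gain from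
    squaring the Blaschke factor.\<close>
  ultimately have AB: "A \<le> 2 * B" by linarith
  have "b * A \<le> a * (2 * B)" using ab AB b nonneg by (intro mult_mono) auto
  \<comment> \<open>With |1 - cnj c z|^2 = A + a w and |1 - cnj \<mu> z|^2 = B + b w, the terms A^2
    B cancel in the difference of the squared sides, and what remains is this multiple of
    \<open>w\<close>.\<close>
  then have "0 \<le> w * (A * (a * (2 * B) - b * A) + a\<^sup>2 * w * B)"
    using w nonneg by (intro mult_nonneg_nonneg add_nonneg_nonneg) auto
  also have "\<dots> = (A + a * w)\<^sup>2 * B - A\<^sup>2 * (B + b * w)"
    by (simp add: power2_eq_square algebra_simps)
  finally show "((cmod (z - c))\<^sup>2 * cmod (1 - cnj \<mu> * z))\<^sup>2 \<le> ((cmod (1 - cnj c * z))\<^sup>2 * cmod (z - \<mu>))\<^sup>2"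
    unfolding power_mult_distrib cmod_sq_one_minus_cnj_mult
    by (simp add: A_def B_def a_def b_def w_def)
qed simp

section \<open>Test vectors for the weighted shift\<close>

definition seq3 :: "complex \<Rightarrow> complex \<Rightarrow> complex \<Rightarrow> int \<Rightarrow> complex" where
  "seq3 a b d n = (if n = 0 then a else if n = 1 then b else if n = 2 then d else 0)"

lemma seq3_sq_has_sum: "((\<lambda>n. (cmod (seq3 a b d n))\<^sup>2) has_sum ((cmod a)\<^sup>2 + (cmod b)\<^sup>2 + (cmod d)\<^sup>2)) UNIV"
proof -
  have "((\<lambda>n. (cmod (seq3 a b d n))\<^sup>2) has_sum (\<Sum>n\<in>{0, 1, 2}. (cmod (seq3 a b d n))\<^sup>2)) {0, 1, 2}"
    by (rule has_sum_finite) simp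
  also have "(\<Sum>n\<in>{0, 1, 2}. (cmod (seq3 a b d n))\<^sup>2) = (cmod a)\<^sup>2 + (cmod b)\<^sup>2 + (cmod d)\<^sup>2"
    by (simp add: seq3_def)
  finally show ?thesis
    by (rule has_sum_cong_neutral[THEN iffD1, rotated -1]) (auto simp: seq3_def)
qed

lemma seq3_ell2: "seq3 a b d \<in> ell2"
  using has_sum_imp_summable[OF seq3_sq_has_sum] by (simp add: ell2_def)

text \<open>Obtained by solving (T - \<mu>) y = e_0 downwards from index 0: r y(-1) = 1 and r y(n-1)
  = \<mu> y(n) for n < 0. The ratio |\<mu>| / r of the geometric sequence is what ties the method to
  points of modulus below r.\<close>

definition resolvent_seq :: "real \<Rightarrow> complex \<Rightarrow> int \<Rightarrow> complex" where
  "resolvent_seq r \<mu> n = (if n < 0 then \<mu> ^ nat (- n - 1) / of_real r ^ nat (- n) else 0)"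

lemma resolvent_seq_sq_has_sum:
  assumes "0 < r" "cmod \<mu> < r"
  shows "((\<lambda>n. (cmod (resolvent_seq r \<mu> n))\<^sup>2) has_sum (1 / (r\<^sup>2 - (cmod \<mu>)\<^sup>2))) UNIV"
proof -
  define \<rho> where "\<rho> = (cmod \<mu>)\<^sup>2 / r\<^sup>2"
  have \<rho>: "0 \<le> \<rho>" "\<rho> < 1"
    using assms by (auto simp: \<rho>_def power_strict_mono)
  define h :: "nat \<Rightarrow> int" where "h = (\<lambda>j. - int j - 1)"
  have h: "inj h" by (auto simp: h_def inj_def)
  have "(\<lambda>j. \<rho> ^ j * (1 / r\<^sup>2)) sums (1 / (1 - \<rho>) * (1 / r\<^sup>2))"
    using \<rho> by (intro sums_mult2 geometric_sums) simp
  moreover have "1 / (1 - \<rho>) * (1 / r\<^sup>2) = 1 / (r\<^sup>2 - (cmod \<mu>)\<^sup>2)"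
    using assms by (simp add: \<rho>_def field_simps)
  moreover have "\<rho> ^ j * (1 / r\<^sup>2) = (cmod (resolvent_seq r \<mu> (h j)))\<^sup>2" for j
  proof -
    have "nat (- h j - 1) = j" "nat (- h j) = Suc j" "h j < 0" by (simp_all add: h_def)
    then have "cmod (resolvent_seq r \<mu> (h j)) = cmod \<mu> ^ j / r ^ Suc j"
      using assms by (simp only: resolvent_seq_def if_True norm_divide norm_power norm_of_real abs_of_pos)
    then show ?thesis
      by (simp add: \<rho>_def power_divide power_mult_distrib mult.commute flip: power_mult)
  qed
  ultimately have "((\<lambda>n. (cmod (resolvent_seq r \<mu> n))\<^sup>2) \<circ> h has_sum (1 / (r\<^sup>2 - (cmod \<mu>)\<^sup>2))) UNIV"
    using sums_nonneg_imp_has_sum[of "\<lambda>j. (cmod (resolvent_seq r \<mu> (h j)))\<^sup>2"] by (simp add: comp_def)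
  then have range: "((\<lambda>n. (cmod (resolvent_seq r \<mu> n))\<^sup>2) has_sum (1 / (r\<^sup>2 - (cmod \<mu>)\<^sup>2))) (range h)"
    using has_sum_reindex[OF h] by blast
  have zero: "resolvent_seq r \<mu> n = 0" if "n \<notin> range h" for n
  proof -
    have "n \<ge> 0"
    proof (rule ccontr)
      assume "\<not> n \<ge> 0"
      then have "n = h (nat (- n - 1))" by (simp add: h_def)
      with that show False by blast
    qed
    then show ?thesis by (simp add: resolvent_seq_def)
  qed
  show ?thesis
    by (rule has_sum_cong_neutral[THEN iffD1, rotated -1, OF range]) (auto simp: zero)
qed

lemma resolvent_seq_ell2: "0 < r \<Longrightarrow> cmod \<mu> < r \<Longrightarrow> resolvent_seq r \<mu> \<in> ell2"
  using has_sum_imp_summable[OF resolvent_seq_sq_has_sum] by (simp add: ell2_def)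

text \<open>For a constant weight w with u = |w|^2 the class condition reads (1 - u) (u - r^2) >= 0,
  so r and 1 are the extreme choices. Index 0 carries r because weights belong to the target: e_(-1)
  goes to r e_0.\<close>

definition witness_weight :: "real \<Rightarrow> int \<Rightarrow> complex" where
  "witness_weight r n = (if n \<le> 0 then of_real r else 1)"

section \<open>Scalar operators and the weighted shift as witnesses\<close>

context ell2_embedding
begin

lemma not_spectral_set_scalar:
  assumes "l \<notin> X"
  shows "\<not> spectral_set X L (transport g (wshift (\<lambda>_. l) 0))"
proof -
  define e where "e = g (seq3 1 0 0)"
  have e: "e \<in> carrier L" using seq3_ell2 by (simp add: e_def)
  have "seq3 1 0 0 0 \<noteq> 0" by (simp add: seq3_def)
  then have "seq3 1 0 0 \<noteq> (\<lambda>_. 0)" by auto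
  then have "e \<noteq> \<zero>\<^bsub>L\<^esub>" using inj by (simp add: e_def inj_eq)
  have eig: "transport g (wshift (\<lambda>_. l) 0) e \<ominus>\<^bsub>L\<^esub> l \<odot>\<^bsub>L\<^esub> e = \<zero>\<^bsub>L\<^esub>"
    using seq3_ell2 by (simp add: e_def wshift_def minus_ell2)
  have "l \<in> op_spectrum L (transport g (wshift (\<lambda>_. l) 0))"
  proof (rule ccontr)
    assume "l \<notin> op_spectrum L (transport g (wshift (\<lambda>_. l) 0))"
    then obtain S where S: "S \<in> bounded_ops L" "S \<zero>\<^bsub>L\<^esub> = e"
      using e eig by (auto simp: op_spectrum_def op_invertible_def)
    have "S (0 \<odot>\<^bsub>L\<^esub> e) = 0 \<odot>\<^bsub>L\<^esub> S e" by (rule bounded_opsD(3)[OF S(1) e])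
    then have "e = \<zero>\<^bsub>L\<^esub>" using S e bounded_opsD(1)[OF S(1) e] by (simp only: scale_zero)
    then show False using \<open>e \<noteq> \<zero>\<^bsub>L\<^esub>\<close> by simp
  qed
  then show ?thesis using assms by (auto simp: spectral_set_def)
qed

definition witness :: "real \<Rightarrow> 'a \<Rightarrow> 'a" where
  "witness r = transport g (wshift (witness_weight r) (-1))"

lemma witness_C_alpha_star:
  assumes "0 < r" "r < 1"
  shows "(L, witness r) \<in> C_alpha_star r"
  unfolding witness_def
proof (rule transport_wshift_C_alpha_star)
  fix n
  show "cmod (witness_weight r n) \<le> 1" "r \<le> cmod (witness_weight r n)"
    using assms by (auto simp: witness_weight_def)
  have "r\<^sup>2 \<le> 1" using assms by (simp add: power_le_one)
  \<comment> \<open>Equality holds for every \<open>n\<close> except 1, where the weight jumps and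
    the gap is 1 - r^2.\<close>
  then show "(cmod (witness_weight r (n + - 1)))\<^sup>2 * (cmod (witness_weight r n))\<^sup>2 + r\<^sup>2
      \<le> (1 + r\<^sup>2) * (cmod (witness_weight r n))\<^sup>2"
    using assms by (auto simp: witness_weight_def algebra_simps)
qed (rule assms)

lemma witness_bounded: "0 < r \<Longrightarrow> r < 1 \<Longrightarrow> witness r \<in> bounded_ops L"
  using witness_C_alpha_star by (simp add: C_alpha_star_def)

lemma witness_resolvent:
  assumes "0 < r" "cmod \<mu> < r"
  shows "witness r (g (resolvent_seq r \<mu>)) \<ominus>\<^bsub>L\<^esub> \<mu> \<odot>\<^bsub>L\<^esub> g (resolvent_seq r \<mu>) = g (seq3 1 0 0)"
proof -
  have "witness_weight r n * resolvent_seq r \<mu> (n - 1) = \<mu> * resolvent_seq r \<mu> n + seq3 1 0 0 n" for n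
  proof (cases "n < 0")
    case True
    then have "nat (- (n - 1) - 1) = Suc (nat (- n - 1))" "nat (- (n - 1)) = Suc (nat (- n))" by simp_all
    then show ?thesis using True assms by (simp add: witness_weight_def resolvent_seq_def seq3_def)
  next
    case False
    then show ?thesis using assms by (auto simp: witness_weight_def resolvent_seq_def seq3_def)
  qed
  then have eq: "wshift (witness_weight r) (-1) (resolvent_seq r \<mu>) = (\<lambda>n. \<mu> * resolvent_seq r \<mu> n + seq3 1 0 0 n)"
    by (simp add: wshift_def)
  show ?thesis
    using resolvent_seq_ell2[OF assms] seq3_ell2 by (simp add: witness_def eq minus_ell2)
qed

lemma poly_op_witness:
  assumes "0 < r" "r < 1"
  shows "poly_op L [:a, b, d:] (witness r) (g (seq3 1 0 0)) = g (seq3 a b d)"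
proof -
  have shift: "witness r (g (seq3 x y 0)) = g (seq3 0 x y)" for x y
  proof -
    have "wshift (witness_weight r) (-1) (seq3 x y 0) = seq3 0 x y"
      by (auto simp: wshift_def witness_weight_def seq3_def fun_eq_iff)
    then show ?thesis by (simp add: witness_def)
  qed
  have scale: "x \<odot>\<^bsub>L\<^esub> g (seq3 p q s) = g (seq3 (x * p) (x * q) (x * s))" for x p q s
    by (auto simp: seq3_def fun_eq_iff intro!: arg_cong[where f = g])
  have add: "g (seq3 p q s) \<oplus>\<^bsub>L\<^esub> g (seq3 p' q' s') = g (seq3 (p + p') (q + q') (s + s'))" for p q s p' q' s'
    by (auto simp: seq3_def fun_eq_iff intro!: arg_cong[where f = g])
  have mem: "g (seq3 p q s) \<in> carrier L" for p q s by (simp add: seq3_ell2)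
  show ?thesis
    using mem by (simp add: poly_op_pCons[OF witness_bounded[OF assms]] poly_op_0[OF witness_bounded[OF assms]]
        bounded_opsD(1)[OF witness_bounded[OF assms]] shift scale add del: ell2_space_simps)
qed

text \<open>
  The vector \<open>y = resolvent_seq r \<mu>\<close> solves \<open>(T - \<mu>) y = e\<^sub>0\<close>, where \<open>T\<close> acts isometrically on
  \<open>e\<^sub>0, e\<^sub>1, \<dots>\<close>.  For the unitary bilateral shift, \<open>\<parallel>y\<parallel>\<^sup>2 = 1 / (1 - |\<mu>|\<^sup>2)\<close> and the two sides
  would agree because \<open>b\<^sub>c\<^sup>2 / b\<^sub>\<mu>\<close> is unimodular on the circle; the weights \<open>r\<close> make \<open>y\<close> longer.
\<close>

lemma witness_norm_gap:
  fixes t :: real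
  assumes r: "0 < r" "r < 1" and \<mu>: "\<mu> \<noteq> 0" "cmod \<mu> < r" and t: "t \<noteq> 1"
  defines "c \<equiv> of_real t * \<mu>" and "y \<equiv> g (resolvent_seq r \<mu>)"
  shows "hnorm L (poly_op L ([:1, - cnj c:]\<^sup>2 * [:- \<mu>, 1:]) (witness r) y)
       < hnorm L (poly_op L ([:- c, 1:]\<^sup>2 * [:1, - cnj \<mu>:]) (witness r) y)"
proof -
  note T = witness_bounded[OF r]
  define m where "m = (cmod \<mu>)\<^sup>2"
  define s where "s = 1 - m"
  have m: "\<mu> * cnj \<mu> = of_real m" unfolding m_def by (rule complex_norm_square[symmetric])
  have y: "y \<in> carrier L" using resolvent_seq_ell2[OF r(1) \<mu>(2)] by (simp add: y_def)
  have res: "poly_op L [:- \<mu>, 1:] (witness r) y = g (seq3 1 0 0)"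
    using witness_resolvent[OF r(1) \<mu>(2)] poly_op_linear[OF T y] by (simp only: y_def)
  \<comment> \<open>Quotient \<open>U\<close> and remainder \<kappa> of the numerator of f after
    division by z - \<mu>. The remainder is the value at \<mu>, namely (\<mu> - c)^2 (1 -
    |\<mu>|^2).\<close>
  define U where "U = [:\<mu> * of_real (s * (1 - 2 * t) - t\<^sup>2 * m), of_real (s + 2 * t * m), - cnj \<mu>:]"
  define \<kappa> where "\<kappa> = \<mu>\<^sup>2 * of_real ((1 - t)\<^sup>2 * s)"
  have decomp: "[:- c, 1:]\<^sup>2 * [:1, - cnj \<mu>:] = U * [:- \<mu>, 1:] + [:\<kappa>:]"
proof -
    have s': "complex_of_real s = 1 - \<mu> * cnj \<mu>" by (simp add: s_def m)
    have "[:- c, 1:]\<^sup>2 * [:1, - cnj \<mu>:]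
        = [:c\<^sup>2, - 2 * c - c\<^sup>2 * cnj \<mu>, 1 + 2 * c * cnj \<mu>, - cnj \<mu>:]"
      by (simp add: power2_eq_square algebra_simps)
    also have "c\<^sup>2 = \<kappa> - \<mu> * coeff U 0"
      unfolding c_def \<kappa>_def U_def coeff_pCons_0 of_real_mult of_real_add of_real_diff of_real_power s' m[symmetric]
        of_real_1 of_real_numeral by (simp add: power2_eq_square algebra_simps)
    also have "- 2 * c - (\<kappa> - \<mu> * coeff U 0) * cnj \<mu> = coeff U 0 - \<mu> * coeff U 1"
      unfolding c_def \<kappa>_def U_def coeff_pCons_0 One_nat_def coeff_pCons_Suc
        of_real_mult of_real_add of_real_diff of_real_power s' m[symmetric]
        of_real_1 of_real_numeral by (simp add: power2_eq_square algebra_simps)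
    also have "1 + 2 * c * cnj \<mu> = coeff U 1 - \<mu> * coeff U 2"
      unfolding c_def U_def One_nat_def numeral_2_eq_2 coeff_pCons_0 coeff_pCons_Suc
        of_real_mult of_real_add of_real_diff of_real_power s' m[symmetric]
        of_real_1 of_real_numeral by (simp add: power2_eq_square algebra_simps)
    also have "[:\<kappa> - \<mu> * coeff U 0, coeff U 0 - \<mu> * coeff U 1, coeff U 1 - \<mu> * coeff U 2, - cnj \<mu>:]
        = U * [:- \<mu>, 1:] + [:\<kappa>:]"
      by (simp add: U_def numeral_2_eq_2 algebra_simps)
    finally show ?thesis .
  qed
  \<comment> \<open>By \<open>res\<close> the quotient acts on e_0 and contributes its coefficients,
    while the remainder leaves a multiple of \<open>y\<close>.\<close>
  have numer: "poly_op L ([:- c, 1:]\<^sup>2 * [:1, - cnj \<mu>:]) (witness r) y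
      = g (\<lambda>n. seq3 (coeff U 0) (coeff U 1) (coeff U 2) n + \<kappa> * resolvent_seq r \<mu> n)"
    unfolding decomp using y
    by (simp only: poly_op_add[OF T] poly_op_mult[OF T] poly_op_const[OF T] res)
       (simp add: U_def poly_op_witness[OF r] y_def numeral_2_eq_2)
  have denom: "poly_op L ([:1, - cnj c:]\<^sup>2 * [:- \<mu>, 1:]) (witness r) y
      = g (seq3 1 (- 2 * cnj c) ((cnj c)\<^sup>2))"
  proof -
    have "[:1, - cnj c:]\<^sup>2 = [:1, - 2 * cnj c, (cnj c)\<^sup>2:]" by (simp add: power2_eq_square)
    then show ?thesis using y by (simp only: poly_op_mult[OF T] res poly_op_witness[OF r])
  qed
  have U: "(cmod (coeff U 0))\<^sup>2 = m * (s * (1 - 2 * t) - t\<^sup>2 * m)\<^sup>2"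
    "(cmod (coeff U 1))\<^sup>2 = (s + 2 * t * m)\<^sup>2" "(cmod (coeff U 2))\<^sup>2 = m"
    by (simp_all add: U_def norm_mult power_mult_distrib m_def numeral_2_eq_2
        del: of_real_add of_real_diff of_real_mult of_real_power)
  have \<kappa>: "(cmod \<kappa>)\<^sup>2 = m\<^sup>2 * ((1 - t)\<^sup>2 * s)\<^sup>2"
    by (simp add: \<kappa>_def norm_mult norm_power power_mult_distrib m_def del: of_real_mult of_real_power of_real_diff)
  have "((\<lambda>n. (cmod (seq3 (coeff U 0) (coeff U 1) (coeff U 2) n))\<^sup>2 + (cmod \<kappa>)\<^sup>2 * (cmod (resolvent_seq r \<mu> n))\<^sup>2)
      has_sum (((cmod (coeff U 0))\<^sup>2 + (cmod (coeff U 1))\<^sup>2 + (cmod (coeff U 2))\<^sup>2)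
        + (cmod \<kappa>)\<^sup>2 * (1 / (r\<^sup>2 - (cmod \<mu>)\<^sup>2)))) UNIV"
    by (intro has_sum_add seq3_sq_has_sum has_sum_cmult_right resolvent_seq_sq_has_sum r \<mu>)
  \<comment> \<open>Pythagoras: one summand lives on the indices 0, 1, 2 and the other on the
    negative ones.\<close>
  moreover have "(cmod (seq3 (coeff U 0) (coeff U 1) (coeff U 2) n))\<^sup>2 + (cmod \<kappa>)\<^sup>2 * (cmod (resolvent_seq r \<mu> n))\<^sup>2
      = (cmod (seq3 (coeff U 0) (coeff U 1) (coeff U 2) n + \<kappa> * resolvent_seq r \<mu> n))\<^sup>2" for n
    by (cases "n < 0")
       (simp_all add: seq3_def resolvent_seq_def norm_mult norm_divide norm_power power_mult_distrib power_divide)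
  ultimately have numer_sq: "ell2_sq (\<lambda>n. seq3 (coeff U 0) (coeff U 1) (coeff U 2) n + \<kappa> * resolvent_seq r \<mu> n)
      = m * (s * (1 - 2 * t) - t\<^sup>2 * m)\<^sup>2 + (s + 2 * t * m)\<^sup>2 + m + m\<^sup>2 * ((1 - t)\<^sup>2 * s)\<^sup>2 * (1 / (r\<^sup>2 - m))"
    unfolding ell2_sq_def U \<kappa> by (simp add: infsumI m_def)
  have denom_sq: "ell2_sq (seq3 1 (- 2 * cnj c) ((cnj c)\<^sup>2)) = 1 + 4 * t\<^sup>2 * m + t^4 * m\<^sup>2"
    unfolding ell2_sq_def infsumI[OF seq3_sq_has_sum]
    by (simp add: c_def norm_mult norm_power power_mult_distrib m_def flip: power_mult)
  have "0 < m" using \<mu> by (simp add: m_def)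
  have "m < r\<^sup>2" unfolding m_def using \<mu> by (intro power_strict_mono) auto
  have "r\<^sup>2 < 1" using r by (simp add: power_less_one_iff)
  then have s: "0 < s" using \<open>m < r\<^sup>2\<close> by (simp add: s_def)
  have "1 / s < 1 / (r\<^sup>2 - m)" using \<open>m < r\<^sup>2\<close> \<open>r\<^sup>2 < 1\<close> by (intro divide_strict_left_mono) (auto simp: s_def)
  \<comment> \<open>Strict because the remainder \<kappa> is nonzero: \<mu> \<noteq> 0 and t
    \<noteq> 1.\<close>
  then have "m\<^sup>2 * ((1 - t)\<^sup>2 * s)\<^sup>2 * (1 / s) < m\<^sup>2 * ((1 - t)\<^sup>2 * s)\<^sup>2 * (1 / (r\<^sup>2 - m))"
    using \<open>0 < m\<close> s t by (intro mult_strict_left_mono) auto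
  moreover have "m\<^sup>2 * ((1 - t)\<^sup>2 * s)\<^sup>2 * (1 / s) = m\<^sup>2 * (1 - t)^4 * s"
    using s by (simp add: power2_eq_square power4_eq_xxxx)
  \<comment> \<open>The case of the unitary shift, |y|^2 = 1/s, where unimodularity of f on the
    circle appears as an identity in \<open>m\<close> and \<open>t\<close>.\<close>
  moreover have "m * (s * (1 - 2 * t) - t\<^sup>2 * m)\<^sup>2 + (s + 2 * t * m)\<^sup>2 + m + m\<^sup>2 * (1 - t)^4 * s
      = 1 + 4 * t\<^sup>2 * m + t^4 * m\<^sup>2"
    unfolding s_def by (simp add: power2_eq_square power4_eq_xxxx algebra_simps)
  ultimately have "ell2_sq (seq3 1 (- 2 * cnj c) ((cnj c)\<^sup>2))
      < ell2_sq (\<lambda>n. seq3 (coeff U 0) (coeff U 1) (coeff U 2) n + \<kappa> * resolvent_seq r \<mu> n)"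
    unfolding numer_sq denom_sq by linarith
  then show ?thesis
    unfolding numer denom
    using seq3_ell2 resolvent_seq_ell2[OF r(1) \<mu>(2)] by (simp add: hnorm_ell2)
qed

lemma not_spectral_set_witness:
  assumes r: "0 < r" "r < 1" and X: "X \<subseteq> cball 0 1" "X \<noteq> {}"
    and \<mu>: "\<mu> \<noteq> 0" "cmod \<mu> < r" and e: "e > 0" "\<And>z. z \<in> X \<Longrightarrow> e \<le> cmod (z - \<mu>)"
  shows "\<not> spectral_set X L (witness r)"
proof
  assume spec: "spectral_set X L (witness r)"
  \<comment> \<open>t < 1 keeps c apart from \<mu>, so the pole survives; 1 - t \<le> e/4 brings c
    as close as \<open>blaschke_square_le\<close> demands; the minimum keeps t nonnegative.\<close>
  define t where "t = 1 - min 1 (e / 4)"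
  have t: "0 \<le> t" "t < 1" "1 - t \<le> e / 4" using e by (auto simp: t_def)
  define c where "c = of_real t * \<mu>"
  have c: "cmod c \<le> cmod \<mu>" using t by (simp add: c_def norm_mult mult_left_le_one_le)
  have "\<mu> - c = of_real (1 - t) * \<mu>" by (simp add: c_def algebra_simps)
  then have "cmod (\<mu> - c) = (1 - t) * cmod \<mu>" using t by (simp add: norm_mult del: of_real_diff)
  also have "\<dots> \<le> (e / 4) * 1" using t \<mu> r e by (intro mult_mono) auto
  finally have close: "4 * cmod (\<mu> - c) \<le> e" by simp
  have lin: "poly [:- a, 1:] z = z - a" "poly [:1, - cnj a:] z = 1 - cnj a * z" for a z :: complex
    by (simp_all add: mult.commute)
  have "hnorm L (poly_op L ([:- c, 1:]\<^sup>2 * [:1, - cnj \<mu>:]) (witness r) (g (resolvent_seq r \<mu>)))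
      \<le> hnorm L (poly_op L ([:1, - cnj c:]\<^sup>2 * [:- \<mu>, 1:]) (witness r) (g (resolvent_seq r \<mu>)))"
  proof (rule spectral_set_bound[OF spec witness_bounded[OF r] _ X(2)])
    show "g (resolvent_seq r \<mu>) \<in> carrier L" using resolvent_seq_ell2[OF r(1) \<mu>(2)] by simp
    fix z assume z: "z \<in> X"
    then have z1: "cmod z \<le> 1" using X by auto
    have "cmod (cnj c * z) \<le> cmod \<mu> * 1" unfolding norm_mult using c z1 by (intro mult_mono) auto
    then have "1 - cnj c * z \<noteq> 0" using \<mu>(2) r(2) by auto
    moreover have "z \<noteq> \<mu>" using e z by fastforce
    ultimately show "poly ([:1, - cnj c:]\<^sup>2 * [:- \<mu>, 1:]) z \<noteq> 0" by (simp add: mult.commute)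
    have "(cmod (z - c))\<^sup>2 * cmod (1 - cnj \<mu> * z) \<le> (cmod (1 - cnj c * z))\<^sup>2 * cmod (z - \<mu>)"
      using close e(2)[OF z] c \<mu>(2) r(2) by (intro blaschke_square_le[OF z1]) auto
    then show "cmod (poly ([:- c, 1:]\<^sup>2 * [:1, - cnj \<mu>:]) z) \<le> cmod (poly ([:1, - cnj c:]\<^sup>2 * [:- \<mu>, 1:]) z)"
      unfolding poly_mult poly_power lin norm_mult norm_power .
  qed
  then show False using witness_norm_gap[OF r \<mu>, of t] t unfolding c_def by simp
qed

lemma C_alpha_star_witness:
  assumes r: "0 < r" "r < 1" and X: "compact X" "X \<subset> cball 0 1"
  shows "\<exists>(H, T)\<in>(C_alpha_star r :: ('a hilbert \<times> ('a \<Rightarrow> 'a)) set). \<not> spectral_set X H T"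
proof (cases "\<exists>l. l \<notin> X \<and> r \<le> cmod l \<and> cmod l \<le> 1")
  case True
  then obtain l where l: "l \<notin> X" "r \<le> cmod l" "cmod l \<le> 1" by blast
  have "(L, transport g (wshift (\<lambda>_. l) 0)) \<in> C_alpha_star r"
  proof (rule transport_wshift_C_alpha_star)
    define u where "u = (cmod l)\<^sup>2"
    have "r\<^sup>2 \<le> u" "u \<le> 1" using l r by (simp_all add: u_def power_mono power_le_one)
    \<comment> \<open>The class condition for the scalar l in factored form; it holds for all moduli
      between r and 1.\<close>
    then have "0 \<le> (1 - u) * (u - r\<^sup>2)" by simp
    then show "(cmod l)\<^sup>2 * (cmod l)\<^sup>2 + r\<^sup>2 \<le> (1 + r\<^sup>2) * (cmod l)\<^sup>2"
      by (simp add: u_def algebra_simps)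
  qed (use l r in auto)
  then show ?thesis using not_spectral_set_scalar[OF l(1)] by blast
next
  case False
  have op: "open (- X)" using X(1) by (simp add: compact_imp_closed open_Compl)
  \<comment> \<open>Guarantees that \<open>X\<close> is nonempty, as
    \<open>not_spectral_set_witness\<close> demands.\<close>
  have "(1::complex) \<in> X" using False r by (metis less_imp_le norm_one order_refl)
  obtain v where v: "v \<in> cball 0 1" "v \<notin> X" using X(2) by blast
  then have vr: "cmod v < r" using False by force
  obtain d where d: "d > 0" "ball v d \<subseteq> - X" using op v by (auto simp: open_contains_ball)
  \<comment> \<open>The gap carries the factor \<mu>^2, so a hole at the origin is probed at a
    nearby nonzero point.\<close>
  obtain \<mu> where \<mu>: "\<mu> \<notin> X" "\<mu> \<noteq> 0" "cmod \<mu> < r"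
  proof (cases "v = 0")
    case True
    define x where "x = min d r / 2"
    have "of_real x \<in> ball v d" "0 < x" "x < r" using d r True by (auto simp: x_def)
    then show ?thesis using d that[of "of_real x"] by auto
  next
    case False
    then show ?thesis using v vr that by blast
  qed
  obtain e where e: "e > 0" "ball \<mu> e \<subseteq> - X" using op \<mu>(1) by (auto simp: open_contains_ball)
  have "e \<le> cmod (z - \<mu>)" if "z \<in> X" for z
    using e(2) that by (force simp: dist_norm norm_minus_commute)
  then have "\<not> spectral_set X L (witness r)"
    using X \<open>1 \<in> X\<close> \<mu> e by (intro not_spectral_set_witness[OF r _ _ \<mu>(2,3) e(1)]) auto
  then show ?thesis using witness_C_alpha_star[OF r] by blast
qed

end

theorem theorem5p10:
  fixes r :: real
  assumes "0 < r" and "r < 1"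
    and universe: "(UNIV :: complex set) \<lesssim> (UNIV :: 'a set)"
  shows
    "minimal_spectral_set (cball 0 1)
           (C_alpha_star r :: ('a hilbert \<times> ('a \<Rightarrow> 'a)) set) \<and>
     minimal_spectral_set (cball 0 1)
           (C_alpha r \<union> C_alpha_star r :: ('a hilbert \<times> ('a \<Rightarrow> 'a)) set) \<and>
     minimal_spectral_set (cball 0 1)
           (C_1 :: ('a hilbert \<times> ('a \<Rightarrow> 'a)) set)"
proof -
  obtain g :: "(int \<Rightarrow> complex) \<Rightarrow> 'a" where "inj g"
    using lepoll_trans[OF sequences_lepoll_complex universe] by (auto simp: lepoll_def)
  then interpret ell2_embedding g by unfold_locales
  note minimal = minimal_spectral_set_if_C_alpha_star[OF _ _ C_alpha_star_witness[OF assms(1,2)]]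
  show ?thesis
    using C_alpha_subset_C_1[OF assms(1,2)] C_alpha_star_subset_C_1[OF assms(1,2)]
    by (intro conjI minimal) auto
qed

end
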